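(* Let $U(z,\bar z)$ on $\mathbb{C}$ and $\tilde U(u,\bar u)$ on $\mathbb{C}$ be real-valued continuous functions with $\tilde U(u,\bar u)=|z|^2U(z,\bar z)$ for $u=-1/z$, and suppose that $$U(z,\bar z)=\frac{U_+}{|z|^2}+O\left(\frac1{|z|^3}\right),\quad U_+=\mathrm{const},\qquad\text{as } z\to\infty.$$ Let $\mathcal{D}$ be the Dirac operator with potential $U$ (in the chart $z$) and $\tilde U$ (in the chart $u$). Then: 1) $\mathcal{D}$ acts on sections of the spinor bundle $\mathcal{E}$ over $S^2$; 2) solutions $\psi$ on $\mathbb{C}$ to $\mathcal{D}\psi=0$ satisfying $|\psi_1|^2+|\psi_2|^2=O\left(\frac1{|z|^2}\right)$ as $z\to\infty$ are in one-to-one correspondence with zero-eigenfunctions of $\mathcal{D}$ acting on sections of $\mathcal{E}$; 3) the kernel of $\mathcal{D}$ is finite-dimensional and, moreover, it is even-dimensional (over $\mathbb{C}$).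
   Context: Notation: $\partial=\partial/\partial z=\frac12(\partial_x-i\partial_y)$, $\bar\partial=\partial/\partial\bar z$. For a real-valued potential $U$ the Dirac operator is $$\mathcal{D}=\begin{pmatrix}0&\partial\\-\bar\partial&0\end{pmatrix}+\begin{pmatrix}U&0\\0&U\end{pmatrix};$$ in the chart $u$ the same formula is used with $\partial_u,\partial_{\bar u}$ and $\tilde U$. The sphere $S^2=\mathbb{C}\cup\{\infty\}$ is covered by two charts with parameters $z\in\mathbb{C}$ and $u=-1/z\in\mathbb{C}$. $\mathcal{E}$ denotes the $\mathbb{C}^2$-bundle $\mathbb{C}^2\to\mathcal{E}\to S^2$ whose sections are given by pairs of vector functions $\psi(z,\bar z)$, $\tilde\psi(u,\bar u)$ on these charts related by $\tilde\psi_1(u,\bar u)=z\,\psi_1(z,\bar z)$, $\tilde\psi_2(u,\bar u)=\bar z\,\psi_2(z,\bar z)$ for $u=-1/z$. That $\mathcal{D}$ acts on sections of $\mathcal{E}$ means that its local expressions in the two charts are compatible with these transition rules, i.e. for a section $(\psi,\tilde\psi)$ one has, on the overlap, $\tilde{\mathcal{D}}\tilde\psi=|z|^2\begin{pmatrix}z&0\\0&\bar z\end{pmatrix}\mathcal{D}\psi$, where $\tilde{\mathcal D}$ is the expression in the chart $u$; in particular the equation $\mathcal{D}\psi=0$ is well defined for sections. A zero-eigenfunction is a section of $\mathcal{E}$ with $\mathcal{D}\psi=0$ in both charts, and the kernel of $\mathcal{D}$ is the complex vector space of zero-eigenfunctions. *)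

theory Defs
  imports "HOL-Analysis.Analysis" "HOL-Library.Function_Algebras" "HOL-Library.Landau_Symbols"
begin

(* "differentiable" and "frechet_derivative" are taken over the reals, also for functions on
   the complex numbers: the derivative in direction 1 is the x-derivative and the one in
   direction \<i> is the y-derivative.  Both values are meaningful only where the function is
   differentiable. *)

definition d_z :: "(complex \<Rightarrow> complex) \<Rightarrow> complex \<Rightarrow> complex" where
  "d_z f z = (frechet_derivative f (at z) 1 - \<i> * frechet_derivative f (at z) \<i>) / 2"

definition d_zbar :: "(complex \<Rightarrow> complex) \<Rightarrow> complex \<Rightarrow> complex" where
  "d_zbar f z = (frechet_derivative f (at z) 1 + \<i> * frechet_derivative f (at z) \<i>) / 2"

definition dirac ::
  "(complex \<Rightarrow> real) \<Rightarrow> (complex \<Rightarrow> complex^2) \<Rightarrow> complex \<Rightarrow> complex^2" where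
  "dirac U \<psi> z =
     vector [d_z (\<lambda>w. \<psi> w $ 2) z, - d_zbar (\<lambda>w. \<psi> w $ 1) z] + of_real (U z) *s \<psi> z"

(* Solutions are classical: everywhere real-differentiable functions satisfying the equation
   at every point.  Continuity of the derivative is not required, because for a merely
   continuous potential the extension of a solution over the point at infinity is
   differentiable there, but its derivative need not be continuous. *)

definition dirac_solution :: "(complex \<Rightarrow> real) \<Rightarrow> (complex \<Rightarrow> complex^2) \<Rightarrow> bool" where
  "dirac_solution U \<psi> \<longleftrightarrow> (\<forall>z. \<psi> differentiable (at z)) \<and> (\<forall>z. dirac U \<psi> z = 0)"

type_synonym spinor_pair = "(complex \<Rightarrow> complex^2) \<times> (complex \<Rightarrow> complex^2)"

(* A section of the bundle is given by its expressions in the charts z and u = - 1 / z. *)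

definition spinor_sections :: "spinor_pair set" where
  "spinor_sections =
     {(\<psi>, \<psi>'). \<forall>z. z \<noteq> 0 \<longrightarrow>
        \<psi>' (- 1 / z) $ 1 = z * \<psi> z $ 1 \<and> \<psi>' (- 1 / z) $ 2 = cnj z * \<psi> z $ 2}"

definition zero_eigenfunctions ::
  "(complex \<Rightarrow> real) \<Rightarrow> (complex \<Rightarrow> real) \<Rightarrow> spinor_pair set" where
  "zero_eigenfunctions U U' =
     {(\<psi>, \<psi>'). (\<psi>, \<psi>') \<in> spinor_sections \<and> dirac_solution U \<psi> \<and> dirac_solution U' \<psi>'}"

definition spinor_scale :: "complex \<Rightarrow> spinor_pair \<Rightarrow> spinor_pair" where
  "spinor_scale c \<Psi> = ((\<lambda>z. c *s fst \<Psi> z), (\<lambda>u. c *s snd \<Psi> u))"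

global_interpretation spinors: vector_space spinor_scale
  by unfold_locales
    (simp_all add: spinor_scale_def fun_eq_iff prod_eq_iff
      vector_scalar_mult_def vec_eq_iff algebra_simps)

end

theory Submission
  imports Defs "HOL-Complex_Analysis.Complex_Analysis"
begin

text \<open>In terms of \<open>f = \<psi>\<^sub>1\<close> and \<open>g = cnj \<psi>\<^sub>2\<close> the Dirac equation prescribes
  \<open>\<partial>f/\<partial>cnj z\<close> and \<open>\<partial>g/\<partial>cnj z\<close>, so everything rests on one estimate for functions \<open>\<Phi>\<close> on
  a punctured disc: if \<open>|\<partial>\<Phi>/\<partial>cnj z|\<close> and \<open>|\<Phi>|\<close> are both \<open>O(|z| powr (-1/2))\<close>, then \<open>\<Phi>\<close> has
  a limit \<open>c\<close> at \<open>0\<close> and \<open>|\<Phi> - c| = O(|z| powr (1/2))\<close> with a uniform constant. Classical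
  solutions need not be \<open>C\<^sup>1\<close>, so Stokes' theorem is replaced by Goursat's bisection argument for
  triangles, combined with dyadic telescoping and the substitution \<open>z = exp w\<close>.
  Applied to \<open>f\<close> and then to \<open>(f - f 0 - b cnj z) / z\<close>, the estimate removes the singularity of a
  decaying solution at infinity. Applied at regular points it is a Hoelder estimate, by which a
  zero-eigenfunction vanishing on a fine finite net vanishes identically; hence the kernel is
  finite-dimensional. Its dimension is even because \<open>(\<psi>\<^sub>1, \<psi>\<^sub>2) \<mapsto> (- cnj \<psi>\<^sub>2, cnj \<psi>\<^sub>1)\<close> is an
  antilinear map of the kernel with square \<open>-1\<close>.\<close>

section \<open>Goursat's estimate\<close>

text \<open>The exponent 1/2 is what lets the estimate feed itself. On the unit disc bounded data
  satisfy its hypotheses, and it returns \<open>f - f 0 = O(sqrt |z|)\<close>. In the chart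
  \<open>u\<close> the remainder \<open>O(1/|z|^3)\<close> becomes a Lipschitz bound for the
  potential at \<open>u = 0\<close>, so the prescribed antiholomorphic derivative also differs from
  its value \<open>b\<close> at the point by \<open>O(sqrt |z|)\<close>. After subtraction of
  \<open>b cnj z\<close> and division by \<open>z\<close> both bounds are
  \<open>O(1 / sqrt |z|)\<close>, which is the hypothesis again; mere continuity of \<open>f\<close>
  would not exclude a quotient of size nearly \<open>1/|z|\<close>. On the cylinder
  \<open>z = exp w\<close> the chain rule contributes a factor \<open>|exp w|\<close>. The bound on
  the derivative becomes \<open>exp (Re w / 2)\<close>, summable over unit steps to the left, while
  the growth \<open>exp (- Re w / 2)\<close> of the function is beaten by the decay
  \<open>exp (Re w)\<close> of the periodic kernel. The predicate \<open>dbar_le\<close> bundles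
  differentiability at one point with a bound on the antilinear coefficient; Goursat's argument uses
  nothing more. All numerical constants are crude, only their uniformity matters.\<close>

definition dbar_le :: "(complex \<Rightarrow> complex) \<Rightarrow> complex \<Rightarrow> real \<Rightarrow> bool" where
  "dbar_le f z k \<longleftrightarrow> (\<exists>A B. (f has_derivative (\<lambda>h. A * h + B * cnj h)) (at z) \<and> cmod B \<le> k)"

lemma dbar_leI: "(f has_derivative (\<lambda>h. A * h + B * cnj h)) (at z) \<Longrightarrow> cmod B \<le> k \<Longrightarrow> dbar_le f z k"
  unfolding dbar_le_def by blast

lemma dbar_le_mono: "dbar_le f z k \<Longrightarrow> k \<le> k' \<Longrightarrow> dbar_le f z k'"
  unfolding dbar_le_def by (meson order_trans)

lemma dbar_le_nonneg: "dbar_le f z k \<Longrightarrow> 0 \<le> k"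
  unfolding dbar_le_def by (meson norm_ge_zero order_trans)

lemma dbar_le_isCont: "dbar_le f z k \<Longrightarrow> isCont f z"
  unfolding dbar_le_def by (meson has_derivative_continuous)

lemma dbar_le_continuous_on: "(\<And>z. z \<in> S \<Longrightarrow> dbar_le f z k) \<Longrightarrow> continuous_on S f"
  using dbar_le_isCont continuous_at_imp_continuous_on by blast

lemma dbar_le_mult_holomorphic:
  assumes "dbar_le f z k" "(g has_field_derivative g') (at z)"
  shows "dbar_le (\<lambda>w. f w * g w) z (k * cmod (g z))"
proof -
  obtain A B where AB: "(f has_derivative (\<lambda>h. A * h + B * cnj h)) (at z)" "cmod B \<le> k"
    using assms(1) unfolding dbar_le_def by blast
  have "((\<lambda>w. f w * g w) has_derivative (\<lambda>h. f z * (g' * h) + (A * h + B * cnj h) * g z)) (at z)"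
    by (rule has_derivative_mult[OF AB(1)]) (use assms(2) in \<open>simp add: has_field_derivative_def\<close>)
  also have "(\<lambda>h. f z * (g' * h) + (A * h + B * cnj h) * g z) =
      (\<lambda>h. (f z * g' + A * g z) * h + (B * g z) * cnj h)"
    by (simp add: fun_eq_iff algebra_simps)
  finally show ?thesis
    by (rule dbar_leI) (simp add: norm_mult AB(2) mult_right_mono)
qed

text \<open>The antilinear coefficient is multiplied by \<open>cnj g'\<close>. For
  \<open>g = exp\<close> this factor turns a singular weight at the puncture into a decaying one on
  the cylinder.\<close>

lemma dbar_le_compose_holomorphic:
  assumes "dbar_le f (g z) k" "(g has_field_derivative g') (at z)"
  shows "dbar_le (\<lambda>w. f (g w)) z (k * cmod g')"
proof -
  obtain A B where AB: "(f has_derivative (\<lambda>h. A * h + B * cnj h)) (at (g z))" "cmod B \<le> k"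
    using assms(1) unfolding dbar_le_def by blast
  have "((\<lambda>w. f (g w)) has_derivative (\<lambda>h. A * (g' * h) + B * cnj (g' * h))) (at z)"
    by (rule has_derivative_compose[of g "\<lambda>h. g' * h"])
      (use assms(2) AB(1) in \<open>simp_all add: has_field_derivative_def\<close>)
  also have "(\<lambda>h. A * (g' * h) + B * cnj (g' * h)) =
      (\<lambda>h. (A * g') * h + (B * cnj g') * cnj h)"
    by (simp add: fun_eq_iff algebra_simps)
  finally show ?thesis
    by (rule dbar_leI) (simp add: norm_mult AB(2) mult_right_mono)
qed

text \<open>Goursat's bisection argument. Near the limit point \<open>x\<close> of the nested triangles the
  complex linear part of \<open>f\<close> integrates to \<open>0\<close>, and the rest is bounded by
  \<open>(k + \<epsilon>) |z - x|\<close>.\<close>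

lemma triangle_integral_le_dbar:
  assumes f: "\<And>z. z \<in> convex hull {a,b,c} \<Longrightarrow> dbar_le f z k"
    and D: "dist a b \<le> D" "dist b c \<le> D" "dist c a \<le> D"
  shows "cmod (contour_integral (linepath a b) f + contour_integral (linepath b c) f
               + contour_integral (linepath c a) f) \<le> 3 * k * D\<^sup>2"
proof (cases "D = 0")
  case True
  then have "a = b" "b = c" using D by auto
  then show ?thesis using True by simp
next
  case False
  then have D0: "D > 0" using D(1) zero_le_dist[of a b] by linarith
  let ?I = "\<lambda>x y. contour_integral (linepath x y) f"
  have contf: "continuous_on (convex hull {a,b,c}) f"
    using f by (rule dbar_le_continuous_on)
  \<comment> \<open>The integral relative to the squared size. Quadrisection always leaves a quarter
    triangle for which this ratio is at least as large, so a bound on \<open>e\<close> from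
    arbitrarily small triangles suffices.\<close>
  define e where "e = cmod (?I a b + ?I b c + ?I c a) / D\<^sup>2"
  define At where "At x y z n \<longleftrightarrow>
      convex hull {x,y,z} \<subseteq> convex hull {a,b,c} \<and>
      dist x y \<le> D/2^n \<and> dist y z \<le> D/2^n \<and> dist z x \<le> D/2^n \<and>
      norm(?I x y + ?I y z + ?I z x) \<ge> e*(D/2^n)^2" for x y z n
  have At0: "At a b c 0"
    using D D0 by (simp add: At_def e_def)
  have AtSuc: "\<exists>x' y' z'. At x' y' z' (Suc n) \<and> convex hull {x',y',z'} \<subseteq> convex hull {x,y,z}"
    if At: "At x y z n" for x y z n
  proof -
    have contf': "continuous_on (convex hull {x,y,z}) f"
      using contf At At_def continuous_on_subset by metis
    show ?thesis
      using At Cauchy_theorem_quadrisection [OF contf', of "D/2^n" e]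
      apply (simp add: At_def algebra_simps)
      apply (meson convex_hull_subset empty_subsetI insert_subset subsetCE)
      done
  qed
  obtain fa fb fc
    where f0: "fa 0 = a" "fb 0 = b" "fc 0 = c"
      and cosb: "\<And>n. convex hull {fa n, fb n, fc n} \<subseteq> convex hull {a,b,c}"
      and dist: "\<And>n. dist (fa n) (fb n) \<le> D/2^n" "\<And>n. dist (fb n) (fc n) \<le> D/2^n"
                "\<And>n. dist (fc n) (fa n) \<le> D/2^n"
      and no: "\<And>n. norm(?I (fa n) (fb n) + ?I (fb n) (fc n) + ?I (fc n) (fa n)) \<ge> e * (D/2^n)^2"
      and conv_le: "\<And>n. convex hull {fa(Suc n), fb(Suc n), fc(Suc n)} \<subseteq> convex hull {fa n, fb n, fc n}"
    by (rule Chain3 [of At, OF At0 AtSuc]) (auto simp: At_def)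
  obtain x where x: "\<And>n. x \<in> convex hull {fa n, fb n, fc n}"
  proof (rule bounded_closed_nest)
    show "\<And>n. closed (convex hull {fa n, fb n, fc n})"
      by (simp add: compact_imp_closed finite_imp_compact_convex_hull)
    show "\<And>m n. m \<le> n \<Longrightarrow> convex hull {fa n, fb n, fc n} \<subseteq> convex hull {fa m, fb m, fc m}"
      by (erule transitive_stepwise_le) (auto simp: conv_le)
  qed (fastforce intro: finite_imp_bounded_convex_hull)+
  obtain A B where AB: "(f has_derivative (\<lambda>h. A * h + B * cnj h)) (at x)" "cmod B \<le> k"
    using f[of x] x[of 0] cosb[of 0] unfolding dbar_le_def by blast
  have "e \<le> 3 * k"
  proof (rule field_le_epsilon)
    fix e0 :: real assume "e0 > 0"
    define \<epsilon> where "\<epsilon> = e0 / 3"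
    have "\<epsilon> > 0" using \<open>e0 > 0\<close> by (simp add: \<epsilon>_def)
    then obtain d where d: "d > 0" and fd: "\<And>y. cmod (y - x) < d \<Longrightarrow>
        cmod (f y - f x - (A * (y - x) + B * cnj (y - x))) \<le> \<epsilon> * cmod (y - x)"
      using AB(1) unfolding has_derivative_at_alt by blast
    obtain n where n: "D / d < 2 ^ n" using real_arch_pow[of 2] by auto
    define r where "r = D / 2 ^ n"
    have r: "0 < r" "r < d" using n d D0 by (auto simp: r_def field_simps)
    define a' b' c' where "a' = fa n" and "b' = fb n" and "c' = fc n"
    let ?T = "convex hull {a',b',c'}"
    define g where "g y = f y - (f x + A * (y - x))" for y
    have cont: "continuous_on ?T f"
      using continuous_on_subset[OF contf cosb[of n]] by (simp add: a'_def b'_def c'_def)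
    have contg: "continuous_on ?T g"
      unfolding g_def by (intro continuous_intros cont)
    have segs: "closed_segment a' b' \<subseteq> ?T" "closed_segment b' c' \<subseteq> ?T" "closed_segment c' a' \<subseteq> ?T"
      by (rule segments_subset_convex_hull)+
    have int: "f contour_integrable_on linepath p q" "g contour_integrable_on linepath p q"
      if "closed_segment p q \<subseteq> ?T" for p q
      using that cont contg continuous_on_subset contour_integrable_continuous_linepath by blast+
    have lin: "((\<lambda>y. f x + A * (y - x)) has_contour_integral
        (f x * q + A * (q - x)\<^sup>2 / 2) - (f x * p + A * (p - x)\<^sup>2 / 2)) (linepath p q)" for p q
    proof -
      have "((\<lambda>y. f x * y + A * (y - x)\<^sup>2 / 2) has_field_derivative (f x + A * (z - x))) (at z within UNIV)" for z
        by (auto intro!: derivative_eq_intros)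
      from contour_integral_primitive[OF this, of "linepath p q"] show ?thesis by simp
    qed
    have eq: "?I p q = contour_integral (linepath p q) g
        + ((f x * q + A * (q - x)\<^sup>2 / 2) - (f x * p + A * (p - x)\<^sup>2 / 2))"
      if "closed_segment p q \<subseteq> ?T" for p q
    proof -
      have "contour_integral (linepath p q) (\<lambda>y. g y + (f x + A * (y - x))) =
         contour_integral (linepath p q) g + contour_integral (linepath p q) (\<lambda>y. f x + A * (y - x))"
        by (rule contour_integral_add) (use int that has_contour_integral_integrable[OF lin] in auto)
      then show ?thesis using contour_integral_unique[OF lin] by (simp add: g_def)
    qed
    have dist': "dist a' b' \<le> r" "dist b' c' \<le> r" "dist c' a' \<le> r"
      using dist[of n] by (auto simp: a'_def b'_def c'_def r_def)
    have gle: "cmod (g y) \<le> (k + \<epsilon>) * r" if "y \<in> ?T" for y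
    proof -
      have "cmod (y - x) \<le> r"
        using triangle_points_closer[of x a' b' c' y] that x[of n] dist'
        by (auto simp: a'_def b'_def c'_def dist_norm norm_minus_commute)
      moreover from this r have "cmod (y - x) < d" by simp
      then have "cmod (g y - B * cnj (y - x)) \<le> \<epsilon> * cmod (y - x)"
        using fd[of y] by (simp add: g_def algebra_simps)
      moreover have "cmod (B * cnj (y - x)) \<le> k * cmod (y - x)"
        using AB(2) by (simp add: norm_mult mult_right_mono del: complex_cnj_diff)
      ultimately have "cmod (g y) \<le> (k + \<epsilon>) * cmod (y - x)"
        using norm_triangle_sub[of "g y" "B * cnj (y - x)"] by (simp add: algebra_simps)
      also have "\<dots> \<le> (k + \<epsilon>) * r"
        using \<open>cmod (y - x) \<le> r\<close> \<open>\<epsilon> > 0\<close> AB(2) norm_ge_zero[of B]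
        by (intro mult_left_mono) linarith+
      finally show ?thesis .
    qed
    have ke: "0 \<le> (k + \<epsilon>) * r" using \<open>\<epsilon> > 0\<close> AB(2) norm_ge_zero[of B] r by (intro mult_nonneg_nonneg) linarith+
    have bnd: "cmod (contour_integral (linepath p q) g) \<le> (k + \<epsilon>) * r * r"
      if "closed_segment p q \<subseteq> ?T" "dist p q \<le> r" for p q
    proof -
      have "cmod (contour_integral (linepath p q) g) \<le> (k + \<epsilon>) * r * cmod (q - p)"
        using that gle ke int by (intro contour_integral_bound_linepath) auto
      also have "\<dots> \<le> (k + \<epsilon>) * r * r"
        using that ke by (intro mult_left_mono) (auto simp: dist_norm norm_minus_commute)
      finally show ?thesis .
    qed
    have "e * r\<^sup>2 \<le> cmod (?I a' b' + ?I b' c' + ?I c' a')"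
      using no[of n] by (simp add: a'_def b'_def c'_def r_def)
    also have "?I a' b' + ?I b' c' + ?I c' a' = contour_integral (linepath a' b') g +
        contour_integral (linepath b' c') g + contour_integral (linepath c' a') g"
      using segs by (simp add: eq)
    also have "cmod \<dots> \<le> 3 * ((k + \<epsilon>) * r * r)"
      by (rule order_trans[OF norm_triangle_mono[OF norm_triangle_mono[OF bnd[OF segs(1) dist'(1)]
            bnd[OF segs(2) dist'(2)]] bnd[OF segs(3) dist'(3)]]]) (simp add: algebra_simps)
    finally have "e * r\<^sup>2 \<le> (3 * (k + \<epsilon>)) * r\<^sup>2" by (simp add: power2_eq_square algebra_simps)
    then have "e \<le> 3 * (k + \<epsilon>)" using r by simp
    then show "e \<le> 3 * k + e0" by (simp add: \<epsilon>_def)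
  qed
  then show ?thesis using D0 by (simp add: e_def field_simps)
qed

text \<open>Cut along the diagonal from \<open>a\<close> to \<open>c\<close>: its two traversals
  cancel, and each triangle contributes \<open>3 * k * D\<^sup>2\<close>.\<close>

lemma quadrilateral_integral_le_dbar:
  assumes f: "\<And>z. z \<in> convex hull {a,b,c,d} \<Longrightarrow> dbar_le f z k"
    and D: "dist a b \<le> D" "dist b c \<le> D" "dist c d \<le> D" "dist d a \<le> D" "dist a c \<le> D"
  shows "cmod (contour_integral (linepath a b) f + contour_integral (linepath b c) f
               + contour_integral (linepath c d) f + contour_integral (linepath d a) f) \<le> 6 * k * D\<^sup>2"
proof -
  let ?I = "\<lambda>x y. contour_integral (linepath x y) f"
  have "cmod (?I a b + ?I b c + ?I c a) \<le> 3 * k * D\<^sup>2"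
    by (rule triangle_integral_le_dbar)
      (use D hull_mono[of "{a,b,c}" "{a,b,c,d}" convex] in \<open>auto intro!: f simp: dist_commute\<close>)
  moreover have "cmod (?I a c + ?I c d + ?I d a) \<le> 3 * k * D\<^sup>2"
    by (rule triangle_integral_le_dbar)
      (use D hull_mono[of "{a,c,d}" "{a,b,c,d}" convex] in \<open>auto intro!: f simp: dist_commute\<close>)
  moreover have "?I a c = - ?I c a"
    using contour_integral_reversepath[of "linepath c a" f] by simp
  ultimately have "cmod ((?I a b + ?I b c + ?I c a) + (?I a c + ?I c d + ?I d a))
      \<le> 3 * k * D\<^sup>2 + 3 * k * D\<^sup>2"
    by (intro norm_triangle_mono)
  then show ?thesis using \<open>?I a c = - ?I c a\<close> by (simp add: algebra_simps)
qed

section \<open>Cauchy--Pompeiu estimates\<close>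

lemma contour_integral_linepath_swap:
  "contour_integral (linepath b a) f = - contour_integral (linepath a b) f"
  using contour_integral_reversepath[of "linepath a b" f] by simp

lemma contour_integral_linepath_translate:
  "contour_integral (linepath (a + p) (b + p)) f = contour_integral (linepath a b) (\<lambda>z. f (z + p))"
proof -
  have "(+) p \<circ> linepath a b = linepath (a + p) (b + p)"
    by (auto simp: linepath_def fun_eq_iff algebra_simps)
  then show ?thesis using contour_integral_translate[of p "linepath a b" f] by simp
qed

lemma contour_integral_rectpath:
  assumes "continuous_on (path_image (rectpath (Complex a b) (Complex c d))) f"
  shows "contour_integral (rectpath (Complex a b) (Complex c d)) f =
      contour_integral (linepath (Complex a b) (Complex c b)) f +
      contour_integral (linepath (Complex c b) (Complex c d)) f +
      contour_integral (linepath (Complex c d) (Complex a d)) f +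
      contour_integral (linepath (Complex a d) (Complex a b)) f"
proof -
  have int: "f contour_integrable_on linepath p q"
    if "closed_segment p q \<subseteq> path_image (rectpath (Complex a b) (Complex c d))" for p q
    using that assms continuous_on_subset contour_integrable_continuous_linepath by blast
  have "f contour_integrable_on linepath (Complex a b) (Complex c b)"
     "f contour_integrable_on linepath (Complex c b) (Complex c d)"
     "f contour_integrable_on linepath (Complex c d) (Complex a d)"
     "f contour_integrable_on linepath (Complex a d) (Complex a b)"
    by (rule int; auto simp: rectpath_def Let_def path_image_join)+
  then show ?thesis
    by (simp add: rectpath_def Let_def contour_integrable_joinI)
qed

text \<open>The trapezoid lies between a side of a box and its copy of half the size. It stays in
  the half plane at distance \<open>\<delta>\<close> from \<open>0\<close> with unit normal
  \<open>cnj u\<close>, where \<open>1 / z\<close> is holomorphic and bounded by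
  \<open>1 / \<delta>\<close>; hence dividing by \<open>z\<close> costs only that factor.\<close>

lemma trapezoid_integral_le_dbar:
  fixes f :: "complex \<Rightarrow> complex"
  defines "g \<equiv> \<lambda>z. f z / z"
  assumes f: "\<And>z. z \<in> convex hull {a, b, b/2, a/2} \<Longrightarrow> dbar_le f z k"
    and u: "cmod u = 1" "2 * \<delta> \<le> Re (u * a)" "2 * \<delta> \<le> Re (u * b)" "0 < \<delta>"
    and D: "cmod a \<le> D / 2" "cmod b \<le> D / 2"
  shows "cmod (contour_integral (linepath a b) g - contour_integral (linepath (a/2) (b/2)) g
           + contour_integral (linepath b (b/2)) g - contour_integral (linepath a (a/2)) g)
         \<le> 6 * (k / \<delta>) * D\<^sup>2"
proof -
  have "convex hull {a, b, b/2, a/2} \<subseteq> {z. \<delta> \<le> cnj u \<bullet> z}"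
  proof (rule hull_minimal)
    show "convex {z. \<delta> \<le> cnj u \<bullet> z}" by (rule convex_halfspace_ge)
  qed (use u in \<open>auto simp: inner_complex_def\<close>)
  then have far: "\<delta> \<le> cmod z" if "z \<in> convex hull {a, b, b/2, a/2}" for z
    using that norm_cauchy_schwarz[of "cnj u" z] u(1) by fastforce
  have g: "dbar_le g z (k / \<delta>)" if z: "z \<in> convex hull {a, b, b/2, a/2}" for z
  proof -
    have nz: "z \<noteq> 0" using far[OF z] u(4) by auto
    have "dbar_le (\<lambda>w. f w * inverse w) z (k * cmod (inverse z))"
      by (rule dbar_le_mult_holomorphic[OF f[OF z] DERIV_inverse[OF nz]])
    moreover have "k * cmod (inverse z) \<le> k / \<delta>"
      using far[OF z] u(4) dbar_le_nonneg[OF f[OF z]] nz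
      by (simp add: norm_inverse divide_inverse mult_left_mono le_imp_inverse_le)
    ultimately show ?thesis
      unfolding g_def by (simp add: divide_inverse dbar_le_mono)
  qed
  have D0: "0 \<le> D" using norm_ge_zero[of a] D(1) by linarith
  have dst: "dist x y \<le> D" if "cmod x \<le> D/2" "cmod y \<le> D/2" for x y
    using norm_triangle_ineq4[of x y] that by (simp add: dist_norm)
  have "cmod (contour_integral (linepath a b) g + contour_integral (linepath b (b/2)) g
     + contour_integral (linepath (b/2) (a/2)) g + contour_integral (linepath (a/2) a) g) \<le> 6 * (k / \<delta>) * D\<^sup>2"
    by (rule quadrilateral_integral_le_dbar[OF g]; (assumption | rule dst); (use D D0 in \<open>simp add: norm_divide\<close>)?)
  then show ?thesis
    by (simp add: contour_integral_linepath_swap[of "b/2" "a/2"] contour_integral_linepath_swap[of "a/2" a] algebra_simps)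
qed

text \<open>A counterclockwise rectangle around \<open>0\<close>. The aspect ratio is chosen so that
  for \<open>r = 1\<close> the horizontal sides are exactly one period \<open>2 * pi * \<i>\<close>
  apart and cancel for periodic integrands.\<close>

definition box_integral :: "(complex \<Rightarrow> complex) \<Rightarrow> real \<Rightarrow> complex" where
  "box_integral g r =
      contour_integral (linepath (Complex (-r) (-r * pi)) (Complex r (-r * pi))) g +
      contour_integral (linepath (Complex r (-r * pi)) (Complex r (r * pi))) g +
      contour_integral (linepath (Complex r (r * pi)) (Complex (-r) (r * pi))) g +
      contour_integral (linepath (Complex (-r) (r * pi)) (Complex (-r) (-r * pi))) g"

lemma norm_Complex_box: "\<bar>x\<bar> \<le> r \<Longrightarrow> \<bar>y\<bar> \<le> r * pi \<Longrightarrow> cmod (Complex x y) \<le> 5 * r"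
  using cmod_le[of "Complex x y"] pi_less_4 mult_left_mono[of pi 4 r] abs_ge_zero[of x] by simp

text \<open>The region between the two boxes consists of four trapezoids whose radial sides cancel
  in pairs. Area of order \<open>r\<^sup>2\<close> against a kernel of order \<open>1 / r\<close>
  leaves a bound linear in \<open>r\<close>, so repeated halving gives a geometric series.\<close>

lemma box_integral_halve:
  assumes f: "\<And>z. z \<in> cbox (Complex (-1) (-pi)) (Complex 1 pi) \<Longrightarrow> dbar_le f z k"
    and r: "0 < r" "r \<le> 1"
  shows "cmod (box_integral (\<lambda>z. f z / z) r - box_integral (\<lambda>z. f z / z) (r/2)) \<le> 4800 * k * r"
proof -
  let ?g = "\<lambda>z. f z / z"
  define T where "T a b = contour_integral (linepath a b) ?g - contour_integral (linepath (a/2) (b/2)) ?g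
           + contour_integral (linepath b (b/2)) ?g - contour_integral (linepath a (a/2)) ?g" for a b
  have rpi: "r * 2 \<le> r * pi" "r * pi \<le> pi" "0 \<le> r * pi"
    using r pi_ge_two by (auto intro: mult_left_mono)
  have T: "cmod (T (Complex x y) (Complex x' y')) \<le> 1200 * k * r"
    if u: "cmod u = 1" "r \<le> Re (u * Complex x y)" "r \<le> Re (u * Complex x' y')"
      and xy: "\<bar>x\<bar> \<le> r" "\<bar>y\<bar> \<le> r * pi" "\<bar>x'\<bar> \<le> r" "\<bar>y'\<bar> \<le> r * pi" for x y x' y' u
  proof -
    have "convex hull {Complex x y, Complex x' y', Complex x' y' / 2, Complex x y / 2}
        \<subseteq> cbox (Complex (-1) (-pi)) (Complex 1 pi)"
      using xy(1,3) r order_trans[OF xy(2) rpi(2)] order_trans[OF xy(4) rpi(2)]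
      by (intro hull_minimal) (auto simp: in_cbox_complex_iff abs_le_iff)
    \<comment> \<open>The smaller side has distance at least \<open>r / 2\<close> from
      \<open>0\<close>, and every vertex has modulus at most \<open>5 * r\<close>, so that
      \<open>D = 10 * r\<close>.\<close>
    then have "cmod (T (Complex x y) (Complex x' y')) \<le> 6 * (k / (r/2)) * (10 * r)\<^sup>2"
      unfolding T_def
      by (intro trapezoid_integral_le_dbar[where u = u])
        (use u xy r norm_Complex_box[of x r y] norm_Complex_box[of x' r y'] f in auto)
    also have "\<dots> = 1200 * k * r" using r by (simp add: field_simps power2_eq_square)
    finally show ?thesis .
  qed
  have half: "Complex x y / 2 = Complex (x/2) (y/2)" for x y
    by (simp add: complex_eq_iff)
  let ?p0 = "Complex (-r) (-r * pi)" and ?p1 = "Complex r (-r * pi)"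
  let ?p2 = "Complex r (r * pi)" and ?p3 = "Complex (-r) (r * pi)"
  have "box_integral ?g r - box_integral ?g (r/2) = T ?p0 ?p1 + T ?p1 ?p2 + T ?p2 ?p3 + T ?p3 ?p0"
    by (simp add: box_integral_def T_def half)
  also have "cmod \<dots> \<le> 1200 * k * r + 1200 * k * r + 1200 * k * r + 1200 * k * r"
  proof (intro norm_triangle_mono)
    \<comment> \<open>For each side \<open>u\<close> is the rotation that carries its outward normal
      to the positive real axis.\<close>
    show "cmod (T ?p0 ?p1) \<le> 1200 * k * r" by (rule T[of \<i>]) (use r rpi in auto)
    show "cmod (T ?p1 ?p2) \<le> 1200 * k * r" by (rule T[of 1]) (use r rpi in auto)
    show "cmod (T ?p2 ?p3) \<le> 1200 * k * r" by (rule T[of "-\<i>"]) (use r rpi in auto)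
    show "cmod (T ?p3 ?p0) \<le> 1200 * k * r" by (rule T[of "-1"]) (use r rpi in auto)
  qed
  finally show ?thesis by simp
qed

lemma closed_segment_halfplane:
  assumes "r \<le> Re (u * a)" "r \<le> Re (u * b)" "z \<in> closed_segment a b"
  shows "r \<le> Re (u * z)"
proof -
  have "closed_segment a b \<subseteq> {z. r \<le> cnj u \<bullet> z}"
    unfolding segment_convex_hull
  proof (rule hull_minimal)
    show "convex {z. r \<le> cnj u \<bullet> z}" by (rule convex_halfspace_ge)
  qed (use assms in \<open>auto simp: inner_complex_def\<close>)
  then show ?thesis using assms(3) by (auto simp: inner_complex_def)
qed

text \<open>Write \<open>f z = f 0 + (f z - f 0)\<close>. The constant part gives
  \<open>2 * pi * \<i> * f 0\<close> because the box winds once around \<open>0\<close>; the rest is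
  small by continuity, the length of the box being of order \<open>r\<close> and the kernel of order
  \<open>1 / r\<close>.\<close>

lemma box_integral_tendsto:
  assumes cont: "continuous_on (cbox (Complex (-1) (-pi)) (Complex 1 pi)) f" and "0 < \<epsilon>"
  obtains d where "0 < d"
    "\<And>r. 0 < r \<Longrightarrow> r < d \<Longrightarrow> r \<le> 1 \<Longrightarrow> cmod (box_integral (\<lambda>z. f z / z) r - 2 * pi * \<i> * f 0) \<le> \<epsilon>"
proof -
  \<comment> \<open>Each of the four sides has length at most \<open>10 * r\<close> and
    \<open>cmod (1 / z) \<le> 1 / r\<close> on it, hence the divisor 40. The later restriction to
    \<open>r < d / 5\<close> comes from the box lying in the ball of radius
    \<open>5 * r\<close>.\<close>
  define \<epsilon>' where "\<epsilon>' = \<epsilon> / 40"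
  have "\<epsilon>' > 0" using assms by (simp add: \<epsilon>'_def)
  let ?B = "cbox (Complex (-1) (-pi)) (Complex 1 pi)"
  have "0 \<in> ?B" by (simp add: in_cbox_complex_iff)
  then obtain d where d: "d > 0" "\<And>z. z \<in> ?B \<Longrightarrow> cmod z < d \<Longrightarrow> cmod (f z - f 0) < \<epsilon>'"
    using cont \<open>\<epsilon>' > 0\<close> unfolding continuous_on_iff by (metis dist_norm diff_zero)
  have "cmod (box_integral (\<lambda>z. f z / z) r - 2 * pi * \<i> * f 0) \<le> \<epsilon>"
    if r: "0 < r" "r < d / 5" "r \<le> 1" for r
  proof -
    have rpi: "r * 2 \<le> r * pi" "r * pi \<le> pi" "0 \<le> r * pi"
      using r pi_ge_two by (auto intro: mult_left_mono)
    let ?I = "\<lambda>a b. contour_integral (linepath a b)"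
    have split: "?I a b (\<lambda>z. f z / z) = f 0 * ?I a b (\<lambda>z. 1 / z) + ?I a b (\<lambda>z. (f z - f 0) / z)"
       (is "_ = ?rhs")
      and bd: "cmod (?I a b (\<lambda>z. (f z - f 0) / z)) \<le> 10 * \<epsilon>'"
      if ab: "a = Complex x y" "b = Complex x' y'"
        and u: "cmod u = 1" "r \<le> Re (u * Complex x y)" "r \<le> Re (u * Complex x' y')"
        and xy: "\<bar>x\<bar> \<le> r" "\<bar>y\<bar> \<le> r * pi" "\<bar>x'\<bar> \<le> r" "\<bar>y'\<bar> \<le> r * pi" for x y x' y' u a b
    proof -
      have far: "r \<le> cmod z" if "z \<in> closed_segment a b" for z
      proof -
        have "r \<le> Re (u * z)" by (rule closed_segment_halfplane[OF _ _ that]) (use u ab in auto)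
        also have "\<dots> \<le> cmod (u * z)" by (rule complex_Re_le_cmod)
        finally show ?thesis by (simp add: norm_mult u)
      qed
      have sub: "closed_segment a b \<subseteq> ?B \<inter> cball 0 (5 * r)"
      proof (rule closed_segment_subset)
        show "convex (?B \<inter> cball 0 (5 * r))" by (intro convex_Int) auto
        show "a \<in> ?B \<inter> cball 0 (5 * r)" "b \<in> ?B \<inter> cball 0 (5 * r)"
          using ab xy(1,3) r order_trans[OF xy(2) rpi(2)] order_trans[OF xy(4) rpi(2)]
            norm_Complex_box[OF xy(1,2)] norm_Complex_box[OF xy(3,4)]
          by (simp_all add: in_cbox_complex_iff abs_le_iff)
      qed
      have contf: "continuous_on (closed_segment a b) f"
        using continuous_on_subset[OF cont] sub by blast
      have nz: "\<forall>z\<in>closed_segment a b. z \<noteq> 0" using far r by fastforce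
      have i1: "(\<lambda>z. 1 / z) contour_integrable_on linepath a b"
        "(\<lambda>z. (f z - f 0) / z) contour_integrable_on linepath a b"
        by (intro contour_integrable_continuous_linepath continuous_intros contf nz)+
      have "?I a b (\<lambda>z. f z / z) = ?I a b (\<lambda>z. f 0 * (1 / z) + (f z - f 0) / z)"
        by (rule contour_integral_eq) (simp add: field_simps diff_divide_distrib)
      also have "\<dots> = ?rhs"
        by (simp only: contour_integral_add[OF contour_integrable_lmul[OF i1(1)] i1(2)]
            contour_integral_lmul[OF i1(1)])
      finally show "?I a b (\<lambda>z. f z / z) = ?rhs" .
      have "cmod (?I a b (\<lambda>z. (f z - f 0) / z)) \<le> \<epsilon>' / r * cmod (b - a)"
      proof (rule contour_integral_bound_linepath[OF i1(2)])
        fix z assume z: "z \<in> closed_segment a b"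
        then have "cmod z \<le> 5 * r" "z \<in> ?B" using sub by auto
        then have "cmod (f z - f 0) \<le> \<epsilon>'" using d(2)[of z] r by simp
        then show "cmod ((f z - f 0) / z) \<le> \<epsilon>' / r"
          using far[OF z] r \<open>\<epsilon>' > 0\<close> by (simp add: norm_divide frac_le)
      qed (use \<open>\<epsilon>' > 0\<close> r in simp)
      also have "cmod (b - a) \<le> 10 * r"
        using norm_triangle_ineq4[of b a] ab xy norm_Complex_box[of x r y] norm_Complex_box[of x' r y']
        by simp
      then have "\<epsilon>' / r * cmod (b - a) \<le> \<epsilon>' / r * (10 * r)"
        using \<open>\<epsilon>' > 0\<close> r by (intro mult_left_mono) auto
      finally show "cmod (?I a b (\<lambda>z. (f z - f 0) / z)) \<le> 10 * \<epsilon>'"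
        using r by simp
    qed
    let ?p0 = "Complex (-r) (-r * pi)" and ?p1 = "Complex r (-r * pi)"
    let ?p2 = "Complex r (r * pi)" and ?p3 = "Complex (-r) (r * pi)"
    have r1: "r \<le> r * pi" using rpi(1) r by linarith
    let ?q = "\<lambda>z. (f z - f 0) / z"
    have s0: "?I ?p0 ?p1 (\<lambda>z. f z / z) = f 0 * ?I ?p0 ?p1 (\<lambda>z. 1 / z) + ?I ?p0 ?p1 ?q"
      "cmod (?I ?p0 ?p1 ?q) \<le> 10 * \<epsilon>'"
      by ((rule split[OF refl refl, of "\<i>"] bd[OF refl refl, of "\<i>"]); use r r1 rpi(3) in simp)+
    have s1: "?I ?p1 ?p2 (\<lambda>z. f z / z) = f 0 * ?I ?p1 ?p2 (\<lambda>z. 1 / z) + ?I ?p1 ?p2 ?q"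
      "cmod (?I ?p1 ?p2 ?q) \<le> 10 * \<epsilon>'"
      by ((rule split[OF refl refl, of "1"] bd[OF refl refl, of "1"]); use r r1 rpi(3) in simp)+
    have s2: "?I ?p2 ?p3 (\<lambda>z. f z / z) = f 0 * ?I ?p2 ?p3 (\<lambda>z. 1 / z) + ?I ?p2 ?p3 ?q"
      "cmod (?I ?p2 ?p3 ?q) \<le> 10 * \<epsilon>'"
      by ((rule split[OF refl refl, of "- \<i>"] bd[OF refl refl, of "- \<i>"]); use r r1 rpi(3) in simp)+
    have s3: "?I ?p3 ?p0 (\<lambda>z. f z / z) = f 0 * ?I ?p3 ?p0 (\<lambda>z. 1 / z) + ?I ?p3 ?p0 ?q"
      "cmod (?I ?p3 ?p0 ?q) \<le> 10 * \<epsilon>'"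
      by ((rule split[OF refl refl, of "-1"] bd[OF refl refl, of "-1"]); use r r1 rpi(3) in simp)+
    have "box_integral (\<lambda>z. 1 / z) r = contour_integral (rectpath ?p0 ?p2) (\<lambda>z. 1 / z)"
    proof -
      have "0 \<notin> path_image (rectpath ?p0 ?p2)"
        using r by (subst path_image_rectpath_cbox_minus_box) (auto simp: in_box_complex_iff)
      then have "continuous_on (path_image (rectpath ?p0 ?p2)) (\<lambda>z. 1 / z)"
        by (intro continuous_intros) auto
      from contour_integral_rectpath[OF this] show ?thesis by (simp add: box_integral_def)
    qed
    also have "\<dots> = 2 * pi * \<i>"
    proof -
      have "winding_number (rectpath ?p0 ?p2) 0 = 1"
        by (rule winding_number_rectpath) (use r in \<open>auto simp: in_box_complex_iff\<close>)
      moreover have "0 \<notin> path_image (rectpath ?p0 ?p2)"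
        using r by (subst path_image_rectpath_cbox_minus_box) (auto simp: in_box_complex_iff)
      ultimately show ?thesis
        using winding_number_valid_path[of "rectpath ?p0 ?p2" 0] by simp
    qed
    finally have one: "box_integral (\<lambda>z. 1 / z) r = 2 * pi * \<i>" .
    have "box_integral (\<lambda>z. f z / z) r = f 0 * box_integral (\<lambda>z. 1 / z) r
        + box_integral (\<lambda>z. (f z - f 0) / z) r"
      unfolding box_integral_def s0(1) s1(1) s2(1) s3(1) by (simp only: algebra_simps)
    then have "box_integral (\<lambda>z. f z / z) r - 2 * pi * \<i> * f 0 = box_integral (\<lambda>z. (f z - f 0) / z) r"
      by (simp add: one)
    moreover have "cmod (box_integral (\<lambda>z. (f z - f 0) / z) r) \<le> 10 * \<epsilon>' + 10 * \<epsilon>' + 10 * \<epsilon>' + 10 * \<epsilon>'"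
      unfolding box_integral_def by (intro norm_triangle_mono s0 s1 s2 s3)
    ultimately show ?thesis by (simp add: \<epsilon>'_def)
  qed
  then show thesis using that[of "d/5"] d by simp
qed

text \<open>Dyadic telescoping from the unit box down to \<open>0\<close>: the errors
  \<open>4800 * k * (1/2)^n\<close> sum to \<open>9600 * k\<close>.\<close>

lemma box_integral_Cauchy:
  assumes f: "\<And>z. z \<in> cbox (Complex (-1) (-pi)) (Complex 1 pi) \<Longrightarrow> dbar_le f z k"
  shows "cmod (box_integral (\<lambda>z. f z / z) 1 - 2 * pi * \<i> * f 0) \<le> 9600 * k"
proof (rule field_le_epsilon)
  fix \<epsilon> :: real assume "0 < \<epsilon>"
  let ?S = "box_integral (\<lambda>z. f z / z)"
  have tele: "cmod (?S 1 - ?S ((1/2)^n)) \<le> 9600 * k * (1 - (1/2)^n)" for n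
  proof (induction n)
    case 0 then show ?case by simp
  next
    case (Suc n)
    have "cmod (?S ((1/2)^n) - ?S ((1/2)^n / 2)) \<le> 4800 * k * (1/2)^n"
      by (rule box_integral_halve[OF f]) (auto simp: power_le_one)
    with Suc have "cmod ((?S 1 - ?S ((1/2)^n)) + (?S ((1/2)^n) - ?S ((1/2)^n / 2)))
       \<le> 9600 * k * (1 - (1/2)^n) + 4800 * k * (1/2)^n"
      by (intro norm_triangle_mono)
    then show ?case by (simp add: algebra_simps)
  qed
  obtain d where d: "0 < d" "\<And>r. 0 < r \<Longrightarrow> r < d \<Longrightarrow> r \<le> 1 \<Longrightarrow> cmod (?S r - 2 * pi * \<i> * f 0) \<le> \<epsilon>"
    using box_integral_tendsto[OF dbar_le_continuous_on[OF f] \<open>0 < \<epsilon>\<close>] by blast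
  obtain n where n: "(1/2::real)^n < d" using real_arch_pow_inv[of d "1/2"] d by auto
  have k0: "0 \<le> k" by (rule dbar_le_nonneg[OF f[of 0]]) (simp add: in_cbox_complex_iff)
  have "cmod ((?S 1 - ?S ((1/2)^n)) + (?S ((1/2)^n) - 2 * pi * \<i> * f 0)) \<le> 9600 * k * (1 - (1/2)^n) + \<epsilon>"
    using d(2)[of "(1/2)^n"] n tele[of n]
    by (intro norm_triangle_mono) (auto simp: power_le_one)
  also have "\<dots> \<le> 9600 * k * 1 + \<epsilon>"
    using k0 by (intro add_right_mono mult_left_mono) auto
  finally show "cmod (?S 1 - 2 * pi * \<i> * f 0) \<le> 9600 * k + \<epsilon>" by simp
qed

section \<open>Periodic functions on a half cylinder\<close>

text \<open>For a function pulled back along \<open>exp\<close> this is \<open>2 * pi * \<i>\<close>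
  times its mean over the circle of radius \<open>exp t\<close>.\<close>

definition vert_integral :: "(complex \<Rightarrow> complex) \<Rightarrow> real \<Rightarrow> complex" where
  "vert_integral f t = contour_integral (linepath (Complex t (-pi)) (Complex t pi)) f"

lemma horizontal_integral_periodic:
  assumes "\<And>z. f (z + 2 * pi * \<i>) = f z"
  shows "contour_integral (linepath (Complex a pi) (Complex b pi)) f =
         contour_integral (linepath (Complex a (-pi)) (Complex b (-pi))) f"
proof -
  have "Complex x pi = Complex x (-pi) + 2 * pi * \<i>" for x by (simp add: complex_eq_iff)
  then show ?thesis using assms by (simp add: contour_integral_linepath_translate)
qed

text \<open>By periodicity the horizontal sides of the rectangle between the two lines cancel. Its
  width is at most 1 and its height below 8, so 9 bounds all distances, and
  \<open>486 = 6 * 9\<^sup>2\<close>.\<close>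

lemma vert_integral_step:
  assumes per: "\<And>z. f (z + 2 * pi * \<i>) = f z"
    and f: "\<And>z. a \<le> Re z \<Longrightarrow> Re z \<le> b \<Longrightarrow> dbar_le f z k"
    and ab: "a \<le> b" "b \<le> a + 1"
  shows "cmod (vert_integral f b - vert_integral f a) \<le> 486 * k"
proof -
  let ?p0 = "Complex a (-pi)" and ?p1 = "Complex b (-pi)"
  let ?p2 = "Complex b pi" and ?p3 = "Complex a pi"
  have "convex hull {?p0, ?p1, ?p2, ?p3} \<subseteq> cbox ?p0 ?p2"
    using ab by (intro hull_minimal) (auto simp: in_cbox_complex_iff)
  then have f': "dbar_le f z k" if "z \<in> convex hull {?p0, ?p1, ?p2, ?p3}" for z
    using that by (intro f) (auto simp: in_cbox_complex_iff)
  have "dist (Complex x y) (Complex x' y') \<le> 9" if "\<bar>x - x'\<bar> \<le> 1" "\<bar>y - y'\<bar> \<le> 8" for x y x' y'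
    using cmod_le[of "Complex x y - Complex x' y'"] that by (simp add: dist_norm)
  then have "cmod (contour_integral (linepath ?p0 ?p1) f + contour_integral (linepath ?p1 ?p2) f
     + contour_integral (linepath ?p2 ?p3) f + contour_integral (linepath ?p3 ?p0) f) \<le> 6 * k * 9\<^sup>2"
    using ab pi_less_4 by (intro quadrilateral_integral_le_dbar[OF f']) auto
  then show ?thesis
    using horizontal_integral_periodic[of f a b, OF per]
    by (simp add: vert_integral_def contour_integral_linepath_swap[of ?p2 ?p3]
        contour_integral_linepath_swap[of ?p3 ?p0])
qed

text \<open>Each unit step to the left shrinks the allowed increment by
  \<open>exp (-1/2) \<le> 2/3\<close>, and the geometric series with ratio \<open>2/3\<close> sums
  to 3.\<close>

lemma dist_le_exp_of_unit_steps:
  fixes h :: "real \<Rightarrow> 'a::metric_space"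
  assumes step: "\<And>x y. a \<le> x \<Longrightarrow> x \<le> y \<Longrightarrow> y \<le> x + 1 \<Longrightarrow> y \<le> b \<Longrightarrow> dist (h x) (h y) \<le> A * exp (y/2)"
    and ab: "a \<le> b"
  shows "dist (h a) (h b) \<le> 3 * A * exp (b/2)"
proof -
  have A: "0 \<le> A" using step[of b b] ab by (simp add: zero_le_mult_iff)
  have e: "exp (-1/2::real) \<le> 2/3"
  proof -
    have "(3/2::real) \<le> exp (1/2)" using exp_ge_add_one_self[of "1/2::real"] by simp
    then have "inverse (exp (1/2::real)) \<le> inverse (3/2)" by (intro le_imp_inverse_le) auto
    then show ?thesis by (simp add: exp_minus)
  qed
  have "dist (h a) (h y) \<le> 3 * A * exp (y/2)" if "a \<le> y" "y \<le> b" "y - a \<le> real n" for y n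
    using that
  proof (induction n arbitrary: y)
    case 0 then show ?case using A by simp
  next
    case (Suc n)
    show ?case
    proof (cases "y - a \<le> 1")
      case True
      then have "dist (h a) (h y) \<le> A * exp (y/2)" using Suc by (intro step) auto
      also have "\<dots> \<le> 3 * A * exp (y/2)" using A by (intro mult_right_mono) auto
      finally show ?thesis .
    next
      case False
      then have "dist (h a) (h (y - 1)) \<le> 3 * A * exp ((y-1)/2)"
        using Suc by (intro Suc.IH) auto
      moreover have "dist (h (y-1)) (h y) \<le> A * exp (y/2)" using False Suc by (intro step) auto
      moreover have "exp ((y-1)/2) = exp (-1/2) * exp (y/2)"
        by (simp add: exp_add[symmetric] field_simps)
      moreover have "A * (exp (-1/2) * exp (y/2)) \<le> A * (2/3 * exp (y/2))"
        using A e by (intro mult_left_mono mult_right_mono) auto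
      ultimately have "dist (h a) (h (y - 1)) + dist (h (y-1)) (h y) \<le> 3 * A * exp (y/2)"
        by simp
      then show ?thesis using dist_triangle[of "h a" "h y" "h (y-1)"] by linarith
    qed
  qed
  from this[of b "nat \<lceil>b - a\<rceil>"] ab show ?thesis by linarith
qed

text \<open>The Todd function: the periodic kernel \<open>1 / (1 - exp (- v))\<close> multiplied by
  \<open>v\<close> to clear its pole, so that the Cauchy estimate for the kernel
  \<open>1 / v\<close> can be applied to it.\<close>

definition todd :: "complex \<Rightarrow> complex" where
  "todd v = (if v = 0 then 1 else v / (1 - exp (- v)))"

text \<open>At \<open>v = 0\<close> both sides are divisions by zero and equal \<open>0\<close>; the
  identity may therefore be used as an unconditional rewrite rule.\<close>

lemma todd_div: "todd v / v = 1 / (1 - exp (- v))"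
  by (simp add: todd_def)

lemma one_minus_exp_eq_0_iff: "\<bar>Im v\<bar> < 2 * pi \<Longrightarrow> 1 - exp (- v) = 0 \<longleftrightarrow> v = 0"
proof
  assume v: "\<bar>Im v\<bar> < 2 * pi" "1 - exp (- v) = 0"
  then have "exp (- v) = 1" by simp
  then obtain n :: int where n: "Re v = 0" "- Im v = of_int (2 * n) * pi"
    unfolding exp_eq_1 by auto
  have "\<bar>Im v\<bar> = 2 * pi * \<bar>of_int n\<bar>"
    using arg_cong[OF n(2), of abs] by (simp add: abs_mult)
  then have "2 * pi * \<bar>of_int n\<bar> < 2 * pi * 1" using v(1) by simp
  then have "\<bar>of_int n :: real\<bar> < 1" by (rule mult_less_cancel_left_pos[THEN iffD1, rotated]) simp
  then have "n = 0" by linarith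
  then show "v = 0" using n by (simp add: complex_eq_iff)
qed simp

text \<open>The reciprocal is the difference quotient at \<open>0\<close> of
  \<open>- exp (- v)\<close>, extended by the derivative 1, hence holomorphic. In this strip
  \<open>0\<close> is the only zero of \<open>1 - exp (- v)\<close>, so inversion is
  harmless.\<close>

lemma holomorphic_todd: "todd holomorphic_on {v. \<bar>Im v\<bar> < 2 * pi}"
proof -
  let ?S = "{v. \<bar>Im v\<bar> < 2 * pi}"
  have "open ?S"
    by (intro open_Collect_less continuous_intros)
  define g :: "complex \<Rightarrow> complex" where "g v = - exp (- v)" for v
  have g': "deriv g 0 = 1"
    unfolding g_def by (rule DERIV_imp_deriv) (auto intro!: derivative_eq_intros)
  have "(\<lambda>v. if v = 0 then deriv g 0 else (g v - g 0) / (v - 0)) holomorphic_on ?S"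
    by (rule pole_lemma_open[OF _ \<open>open ?S\<close>]) (unfold g_def, intro holomorphic_intros)
  then have "(\<lambda>v. if v = 0 then 1 else (1 - exp (- v)) / v) holomorphic_on ?S"
    by (rule holomorphic_transform) (simp add: g', simp add: g_def)
  then have "(\<lambda>v. inverse (if v = 0 then 1 else (1 - exp (- v)) / v)) holomorphic_on ?S"
    by (rule holomorphic_on_inverse) (use one_minus_exp_eq_0_iff in auto)
  then show ?thesis
    by (rule holomorphic_transform) (simp add: todd_def)
qed

lemma vertical_segment_subset: "closed_segment (Complex t a) (Complex t b) \<subseteq> {z. Re z = t}"
  by (auto simp: closed_segment_same_Re)

lemma vert_integral_bound:
  assumes cont: "continuous_on {z. Re z = t} f" and B: "\<And>z. Re z = t \<Longrightarrow> cmod (f z) \<le> B"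
  shows "cmod (vert_integral f t) \<le> 8 * B"
proof -
  have seg: "closed_segment (Complex t (-pi)) (Complex t pi) \<subseteq> {z. Re z = t}"
    by (rule vertical_segment_subset)
  have B0: "0 \<le> B" using order_trans[OF norm_ge_zero B[of "of_real t"]] by simp
  have "cmod (vert_integral f t) \<le> B * cmod (Complex t pi - Complex t (-pi))"
    unfolding vert_integral_def using seg B B0
    by (intro contour_integral_bound_linepath contour_integrable_continuous_linepath
        continuous_on_subset[OF cont]) auto
  also have "cmod (Complex t pi - Complex t (-pi)) \<le> 8"
    using cmod_le[of "Complex t pi - Complex t (-pi)"] pi_less_4 by simp
  then have "B * cmod (Complex t pi - Complex t (-pi)) \<le> B * 8" using B0 by (rule mult_left_mono)
  finally show ?thesis by simp
qed

lemma exp_ge_twice: "1 \<le> x \<Longrightarrow> 2 \<le> exp (x::real)"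
  using exp_ge_add_one_self[of x] by linarith

text \<open>The Cauchy--Pompeiu estimate on a half cylinder. The periodic kernel
  \<open>1 / (1 - exp (- v))\<close> has residue \<open>1\<close> at \<open>0\<close>, decays on the left, and tends to \<open>1\<close>
  on the right.\<close>

lemma periodic_Cauchy_estimate:
  obtains C where "0 < C"
    "\<And>H \<kappa> \<mu> s \<tau>. (\<And>z. H (z + 2 * pi * \<i>) = H z) \<Longrightarrow>
      (\<And>z. Re z \<le> s \<Longrightarrow> dbar_le H z (\<kappa> * exp (Re z / 2))) \<Longrightarrow>
      (\<And>z. Re z \<le> s \<Longrightarrow> cmod (H z) \<le> \<mu> * exp (- Re z / 2)) \<Longrightarrow> 1 \<le> s \<Longrightarrow> \<tau> \<le> 1 \<Longrightarrow>
      cmod (2 * pi * \<i> * H 0 - vert_integral H \<tau>) \<le> C * (\<kappa> + \<mu> * exp (- s))"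
proof -
  let ?B = "cbox (Complex (-1) (-pi)) (Complex 1 pi)"
  have Bsub: "?B \<subseteq> {v. \<bar>Im v\<bar> < 2 * pi}"
  proof
    fix v assume "v \<in> ?B"
    then have "\<bar>Im v\<bar> \<le> pi" by (simp add: in_cbox_complex_iff abs_le_iff)
    then have "\<bar>Im v\<bar> < 2 * pi" using pi_gt_zero by linarith
    then show "v \<in> {v. \<bar>Im v\<bar> < 2 * pi}" by simp
  qed
  have "continuous_on ?B todd"
    by (rule holomorphic_on_imp_continuous_on[OF holomorphic_on_subset[OF holomorphic_todd Bsub]])
  then have "compact (todd ` ?B)"
    by (rule compact_continuous_image) (rule compact_cbox)
  then obtain E where E: "E > 0" "\<And>v. v \<in> ?B \<Longrightarrow> cmod (todd v) \<le> E"
    using bounded_pos[of "todd ` ?B"] compact_imp_bounded by auto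
  \<comment> \<open>The contributions of the box (\<open>9600\<close> times \<open>2 * E\<close>),
    of the three translations of vertical lines (each at most \<open>3 * 972\<close> or
    \<open>3 * 486 * 2\<close>), and of the line \<open>Re z = s\<close>
    (\<open>8 * 2\<close>).\<close>
  define C where "C = 19200 * E + 2916 + 2916 + 2916 + 16"
  have "cmod (2 * pi * \<i> * H 0 - vert_integral H \<tau>) \<le> C * (\<kappa> + \<mu> * exp (- s))"
    if per: "\<And>z. H (z + 2 * pi * \<i>) = H z"
      and dbar: "\<And>z. Re z \<le> s \<Longrightarrow> dbar_le H z (\<kappa> * exp (Re z / 2))"
      and bd: "\<And>z. Re z \<le> s \<Longrightarrow> cmod (H z) \<le> \<mu> * exp (- Re z / 2)"
      and s: "1 \<le> s" and \<tau>: "\<tau> \<le> 1" for H \<kappa> \<mu> s \<tau>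
  proof -
    define k where "k v = 1 / (1 - exp (- v))" for v :: complex
    \<comment> \<open>This is \<open>k - 1\<close>, the part of the kernel that decays on the right.
      The subtracted constant 1 produces the vertical integral of \<open>H\<close> itself.\<close>
    define k2 where "k2 v = 1 / (exp v - 1)" for v :: complex
    have \<kappa>: "0 \<le> \<kappa>" using dbar_le_nonneg[OF dbar[of 0]] s by simp
    have \<mu>: "0 \<le> \<mu>" using order_trans[OF norm_ge_zero bd[of 0]] s by simp
    have e2: "exp (1/2::real) \<le> 2"
      by (rule power2_le_imp_le) (use exp_le in \<open>auto simp: exp_double[symmetric]\<close>)
    have perk: "k (v + 2 * pi * \<i>) = k v" "k2 (v + 2 * pi * \<i>) = k2 v" for v
    proof -
      have "exp (v + 2 * pi * \<i>) = exp v" by (simp add: exp_add mult_ac)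
      moreover have "exp (- (v + 2 * pi * \<i>)) = exp (- v)"
        using \<open>exp (v + 2 * pi * \<i>) = exp v\<close> by (simp only: exp_minus)
      ultimately show "k (v + 2 * pi * \<i>) = k v" "k2 (v + 2 * pi * \<i>) = k2 v"
        by (simp_all only: k_def k2_def)
    qed
    have nz: "exp v \<noteq> 1" if "Re v \<noteq> 0" for v
      using that norm_exp_eq_Re[of v] by (metis exp_eq_one_iff norm_one)
    have kle: "cmod (k v) \<le> 2 * exp (Re v)" if "Re v \<le> - 1" for v
    proof -
      have "exp (- Re v) / 2 \<le> exp (- Re v) - 1" using exp_ge_twice[of "- Re v"] that by simp
      also have "\<dots> \<le> cmod (1 - exp (- v))"
        using norm_triangle_ineq2[of "exp (- v)" 1] by (simp add: norm_minus_commute)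
      finally have "1 / cmod (1 - exp (- v)) \<le> 1 / (exp (- Re v) / 2)"
        by (intro divide_left_mono) (auto intro!: mult_pos_pos elim: less_le_trans[rotated])
      then show ?thesis by (simp add: k_def norm_divide exp_minus field_simps)
    qed
    have k2le: "cmod (k2 v) \<le> 2 * exp (- Re v)" if "1 \<le> Re v" for v
    proof -
      have "exp (Re v) / 2 \<le> exp (Re v) - 1" using exp_ge_twice[of "Re v"] that by simp
      also have "\<dots> \<le> cmod (exp v - 1)"
        using norm_triangle_ineq2[of "exp v" 1] by simp
      finally have "1 / cmod (exp v - 1) \<le> 1 / (exp (Re v) / 2)"
        by (intro divide_left_mono) (auto intro!: mult_pos_pos elim: less_le_trans[rotated])
      then show ?thesis by (simp add: k2_def norm_divide exp_minus field_simps)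
    qed
    have kdiff: "\<exists>g'. (k has_field_derivative g') (at v)" "\<exists>g'. (k2 has_field_derivative g') (at v)"
      if "Re v \<noteq> 0" for v
    proof -
      have "exp v - 1 \<noteq> 0" "1 - exp (- v) \<noteq> 0" using nz[of v] nz[of "- v"] that by auto
      then show "\<exists>g'. (k has_field_derivative g') (at v)" "\<exists>g'. (k2 has_field_derivative g') (at v)"
        unfolding k_def k2_def field_differentiable_def[symmetric]
        by (auto intro!: field_differentiable_divide field_differentiable_diff
            field_differentiable_compose[of uminus _ exp, unfolded o_def]
            field_differentiable_minus field_differentiable_ident field_differentiable_within_exp)
    qed
    have dk: "dbar_le (\<lambda>z. H z * k z) z (\<kappa> * exp (Re z / 2) * cmod (k z))"
         "dbar_le (\<lambda>z. H z * k2 z) z (\<kappa> * exp (Re z / 2) * cmod (k2 z))"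
      if "Re z \<le> s" "Re z \<noteq> 0" for z
      using kdiff[OF that(2)] dbar_le_mult_holomorphic[OF dbar[OF that(1)]] by blast+
    have cont: "continuous_on {z. Re z = t} H" if "t \<le> s" for t
      by (rule dbar_le_continuous_on[where k = "\<kappa> * exp (t / 2)"]) (use dbar that in force)
    have contk: "continuous_on {z. Re z = t} k" "continuous_on {z. Re z = t} k2" if "t \<noteq> 0" for t
      using kdiff that by (auto intro!: continuous_at_imp_continuous_on dest: DERIV_isCont)

    have left: "cmod (vert_integral (\<lambda>z. H z * k z) (-1)) \<le> 2916 * \<kappa>"
    proof -
      let ?h = "vert_integral (\<lambda>z. H z * k z)"
      have step: "dist (?h x) (?h y) \<le> 972 * \<kappa> * exp (y / 2)" if "x \<le> y" "y \<le> x + 1" "y \<le> - 1" for x y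
      proof -
        have "cmod (?h y - ?h x) \<le> 486 * (2 * \<kappa> * exp (y / 2))"
        proof (rule vert_integral_step)
          fix z assume z: "x \<le> Re z" "Re z \<le> y"
          have "\<kappa> * exp (Re z / 2) * cmod (k z) \<le> \<kappa> * exp (y / 2) * (2 * exp (Re z))"
            using z that \<kappa> kle[of z] by (intro mult_mono) auto
          also have "\<dots> \<le> \<kappa> * exp (y / 2) * (2 * 1)"
            using z that \<kappa> by (intro mult_left_mono) auto
          finally show "dbar_le (\<lambda>z. H z * k z) z (2 * \<kappa> * exp (y / 2))"
            using dk(1)[of z] z that s by (auto elim!: dbar_le_mono simp: mult_ac)
        qed (use that per perk in auto)
        then show ?thesis by (simp add: dist_norm norm_minus_commute mult_ac)
      qed
      \<comment> \<open>Move the line to \<open>Re z = - n\<close>: there \<open>H\<close> grows at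
        most like \<open>exp (n / 2)\<close> and the kernel decays like \<open>exp (- n)\<close>, so
        the boundary term vanishes in the limit.\<close>
      have "cmod (?h (-1)) \<le> 2916 * \<kappa> + 16 * \<mu> * exp (- real n / 2)" if "n \<ge> 1" for n :: nat
      proof -
        have "dist (?h (- real n)) (?h (-1)) \<le> 3 * (972 * \<kappa>) * exp (- 1 / 2)"
          by (rule dist_le_exp_of_unit_steps[OF step]) (use that in auto)
        also have "\<dots> \<le> 2916 * \<kappa> * 1" using \<kappa> by (simp add: mult_left_le)
        finally have 1: "dist (?h (- real n)) (?h (-1)) \<le> 2916 * \<kappa>" by simp
        have "cmod (?h (- real n)) \<le> 8 * (2 * \<mu> * exp (- real n / 2))"
        proof (rule vert_integral_bound)
          show "continuous_on {z. Re z = - real n} (\<lambda>z. H z * k z)"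
            using that s by (intro continuous_on_mult cont contk) auto
          fix z assume z: "Re z = - real n"
          have "cmod (H z * k z) \<le> (\<mu> * exp (real n / 2)) * (2 * exp (- real n))"
            unfolding norm_mult using bd[of z] kle[of z] z that s \<mu> by (intro mult_mono) auto
          also have "\<dots> = 2 * \<mu> * exp (- real n / 2)"
            by (simp add: exp_add[symmetric])
          finally show "cmod (H z * k z) \<le> 2 * \<mu> * exp (- real n / 2)" .
        qed
        with 1 show ?thesis
          using norm_triangle_ineq4[of "?h (- real n)" "?h (- real n) - ?h (-1)"] by (simp add: dist_norm)
      qed
      then have ev: "\<forall>\<^sub>F n in sequentially. cmod (?h (-1)) \<le> 2916 * \<kappa> + 16 * \<mu> * exp (- real n / 2)"
        by (rule eventually_mono[OF eventually_ge_at_top])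
      have "(\<lambda>n. exp (- real n / 2)) \<longlonglongrightarrow> 0" by real_asymp
      then have "(\<lambda>n. 2916 * \<kappa> + 16 * \<mu> * exp (- real n / 2)) \<longlonglongrightarrow> 2916 * \<kappa> + 16 * \<mu> * 0"
        by (intro tendsto_intros)
      from tendsto_lowerbound[OF this ev] show ?thesis by simp
    qed

    have right: "cmod (vert_integral (\<lambda>z. H z * k2 z) 1) \<le> 2916 * \<kappa> + 16 * \<mu> * exp (- s)"
    proof -
      \<comment> \<open>The reflection \<open>x \<mapsto> - x\<close> makes the increments, which
        here decay to the right, decay to the left as \<open>dist_le_exp_of_unit_steps\<close>
        expects.\<close>
      let ?h = "\<lambda>x. vert_integral (\<lambda>z. H z * k2 z) (- x)"
      have step: "dist (?h x) (?h y) \<le> 972 * \<kappa> * exp (y / 2)"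
        if "- s \<le> x" "x \<le> y" "y \<le> x + 1" "y \<le> - 1" for x y
      proof -
        have "cmod (?h x - ?h y) \<le> 486 * (2 * \<kappa> * exp (y / 2))"
        proof (rule vert_integral_step)
          fix z assume z: "- y \<le> Re z" "Re z \<le> - x"
          have "\<kappa> * exp (Re z / 2) * cmod (k2 z) \<le> \<kappa> * exp (Re z / 2) * (2 * exp (- Re z))"
            using z that \<kappa> k2le[of z] by (intro mult_left_mono) auto
          also have "\<dots> = 2 * \<kappa> * exp (- Re z / 2)" by (simp add: exp_add[symmetric])
          also have "\<dots> \<le> 2 * \<kappa> * exp (y / 2)" using z \<kappa> by (intro mult_left_mono) auto
          finally show "dbar_le (\<lambda>z. H z * k2 z) z (2 * \<kappa> * exp (y / 2))"
            using dk(2)[of z] z that s by (auto elim!: dbar_le_mono)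
        qed (use that per perk in auto)
        then show ?thesis by (simp add: dist_norm mult_ac)
      qed
      have "dist (?h (- s)) (?h (-1)) \<le> 3 * (972 * \<kappa>) * exp (- 1 / 2)"
        by (rule dist_le_exp_of_unit_steps[OF step]) (use s in auto)
      also have "\<dots> \<le> 2916 * \<kappa> * 1" using \<kappa> by (simp add: mult_left_le)
      finally have 1: "dist (?h (- s)) (?h (-1)) \<le> 2916 * \<kappa>" by simp
      have "cmod (?h (- s)) \<le> 8 * (2 * \<mu> * exp (- s))"
        unfolding minus_minus
      proof (rule vert_integral_bound)
        show "continuous_on {z. Re z = s} (\<lambda>z. H z * k2 z)"
          using s by (intro continuous_on_mult cont contk) auto
        fix z assume z: "Re z = s"
        \<comment> \<open>The factor \<open>exp (- s / 2)\<close> in the bound for \<open>H\<close>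
          is estimated by 1; the decay of \<open>k2\<close> alone gives the required
          \<open>exp (- s)\<close>.\<close>
        have "cmod (H z * k2 z) \<le> (\<mu> * 1) * (2 * exp (- s))"
          unfolding norm_mult using bd[of z] k2le[of z] z s \<mu>
          by (intro mult_mono) (auto elim!: order_trans intro!: mult_left_le)
        then show "cmod (H z * k2 z) \<le> 2 * \<mu> * exp (- s)" by simp
      qed
      with 1 show ?thesis
        using norm_triangle_ineq4[of "?h (- s)" "?h (- s) - ?h (-1)"] by (simp add: dist_norm)
    qed

    have middle: "dist (vert_integral H \<tau>) (vert_integral H 1) \<le> 2916 * \<kappa>"
    proof -
      have "dist (vert_integral H \<tau>) (vert_integral H 1) \<le> 3 * (486 * \<kappa>) * exp (1 / 2)"
      proof (rule dist_le_exp_of_unit_steps[OF _ \<tau>])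
        fix x y assume xy: "\<tau> \<le> x" "x \<le> y" "y \<le> x + 1" "y \<le> 1"
        have "cmod (vert_integral H y - vert_integral H x) \<le> 486 * (\<kappa> * exp (y / 2))"
        proof (rule vert_integral_step)
          fix z assume "x \<le> Re z" "Re z \<le> y"
          then show "dbar_le H z (\<kappa> * exp (y / 2))"
            using dbar[of z] xy s \<kappa> by (auto elim!: dbar_le_mono intro!: mult_left_mono)
        qed (use xy per in auto)
        then show "dist (vert_integral H x) (vert_integral H y) \<le> 486 * \<kappa> * exp (y / 2)"
          by (simp add: dist_norm norm_minus_commute)
      qed
      also have "\<dots> \<le> 3 * (486 * \<kappa>) * 2" using e2 \<kappa> by (intro mult_left_mono) auto
      finally show ?thesis by simp
    qed

    have box: "cmod (box_integral (\<lambda>z. H z * k z) 1 - 2 * pi * \<i> * H 0) \<le> 19200 * E * \<kappa>"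
    proof -
      have "dbar_le (\<lambda>z. H z * todd z) z (2 * E * \<kappa>)" if z: "z \<in> ?B" for z
      proof -
        have "open {v. \<bar>Im v\<bar> < 2 * pi}"
          by (intro open_Collect_less continuous_intros)
        then obtain t' where "(todd has_field_derivative t') (at z)"
          using holomorphic_todd Bsub z holomorphic_on_open by blast
        moreover have z1: "Re z \<le> 1" using z by (simp add: in_cbox_complex_iff)
        ultimately have "dbar_le (\<lambda>z. H z * todd z) z (\<kappa> * exp (Re z / 2) * cmod (todd z))"
          using s by (intro dbar_le_mult_holomorphic dbar) auto
        moreover have "exp (Re z / 2) \<le> 2" using z1 e2 by (rule_tac order_trans[OF _ e2]) auto
        then have "\<kappa> * exp (Re z / 2) * cmod (todd z) \<le> \<kappa> * 2 * E"
          using \<kappa> E(2)[OF z] by (intro mult_mono) auto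
        ultimately show ?thesis by (auto elim!: dbar_le_mono simp: mult_ac)
      qed
      from box_integral_Cauchy[OF this] have
        "cmod (box_integral (\<lambda>z. H z * (todd z / z)) 1 - 2 * pi * \<i> * H 0) \<le> 19200 * E * \<kappa>"
        by (simp add: todd_def[of 0])
      then show ?thesis by (simp only: todd_div k_def)
    qed
    have boxeq: "box_integral (\<lambda>z. H z * k z) 1 =
        vert_integral (\<lambda>z. H z * k z) 1 - vert_integral (\<lambda>z. H z * k z) (-1)"
    proof -
      have "contour_integral (linepath (Complex (-1) pi) (Complex 1 pi)) (\<lambda>z. H z * k z) =
          contour_integral (linepath (Complex (-1) (-pi)) (Complex 1 (-pi))) (\<lambda>z. H z * k z)"
        by (rule horizontal_integral_periodic) (simp only: per perk)
      then show ?thesis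
        by (simp add: box_integral_def vert_integral_def
            contour_integral_linepath_swap[of "Complex 1 pi" "Complex (-1) pi"]
            contour_integral_linepath_swap[of "Complex (-1) pi" "Complex (-1) (-pi)"])
    qed
    have sum: "vert_integral (\<lambda>z. H z * k z) 1 = vert_integral H 1 + vert_integral (\<lambda>z. H z * k2 z) 1"
    proof -
      have seg: "closed_segment (Complex 1 (-pi)) (Complex 1 pi) \<subseteq> {z. Re z = 1}"
        by (rule vertical_segment_subset)
      have "vert_integral (\<lambda>z. H z * k z) 1 = vert_integral (\<lambda>z. H z + H z * k2 z) 1"
        unfolding vert_integral_def
      proof (rule contour_integral_eq)
        fix z assume "z \<in> path_image (linepath (Complex 1 (- pi)) (Complex 1 pi))"
        then have "exp z \<noteq> 1" using seg nz[of z] by auto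
        then have "k z = 1 + k2 z" by (simp add: k_def k2_def exp_minus field_simps)
        then show "H z * k z = H z + H z * k2 z" by (simp add: algebra_simps)
      qed
      also have "\<dots> = vert_integral H 1 + vert_integral (\<lambda>z. H z * k2 z) 1"
        unfolding vert_integral_def
        by (intro contour_integral_add contour_integrable_continuous_linepath continuous_on_mult
            continuous_on_subset[OF cont seg] continuous_on_subset[OF contk(2) seg]) (use s in auto)
      finally show ?thesis .
    qed
    have norm4: "cmod (p - q + r + t) \<le> P + Q + R + T"
      if "cmod p \<le> P" "cmod q \<le> Q" "cmod r \<le> R" "cmod t \<le> T" for p q r t P Q R T
      using that norm_triangle_ineq4[of p q] norm_triangle_ineq[of "p - q" r]
        norm_triangle_ineq[of "p - q + r" t] by linarith
    let ?Z = "2 * pi * \<i> * H 0"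
    \<comment> \<open>The box integral at \<open>r = 1\<close> is the difference of the vertical
      integrals of \<open>H * k\<close> over \<open>Re z = 1\<close> and \<open>Re z = - 1\<close>,
      and on the right line \<open>k = 1 + k2\<close>. This leaves four differences, each already
      bounded.\<close>
    have "?Z - vert_integral H \<tau> = (?Z - box_integral (\<lambda>z. H z * k z) 1)
       - vert_integral (\<lambda>z. H z * k z) (-1) + vert_integral (\<lambda>z. H z * k2 z) 1
       + (vert_integral H 1 - vert_integral H \<tau>)"
      using boxeq sum by simp
    also have "cmod \<dots> \<le> 19200 * E * \<kappa> + 2916 * \<kappa> + (2916 * \<kappa> + 16 * \<mu> * exp (- s)) + 2916 * \<kappa>"
      by (rule norm4) (use box left right middle in \<open>simp_all add: dist_norm norm_minus_commute\<close>)
    also have "\<dots> \<le> C * (\<kappa> + \<mu> * exp (- s))"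
    proof -
      have "0 \<le> (19200 * E + 2916 + 2916 + 2916) * (\<mu> * exp (- s)) + 16 * \<kappa>"
        using E \<mu> \<kappa> by simp
      then show ?thesis by (simp add: C_def algebra_simps)
    qed
    finally show ?thesis .
  qed
  moreover have "0 < C" using E by (simp add: C_def)
  ultimately show thesis using that by blast
qed

section \<open>Isolated singularities\<close>

text \<open>Sliding the window of one period by \<open>\<theta>\<close> adds a piece at the top and
  removes a piece at the bottom, and the two are translates by the period. It allows base points off
  the real axis.\<close>

lemma vert_integral_shift:
  assumes per: "\<And>z. f (z + 2 * pi * \<i>) = f z" and cont: "continuous_on {z. Re z = t} f"
    and \<theta>: "0 \<le> \<theta>" "\<theta> \<le> 2 * pi"
  shows "contour_integral (linepath (Complex t (\<theta> - pi)) (Complex t (\<theta> + pi))) f = vert_integral f t"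
proof -
  let ?I = "\<lambda>a b. contour_integral (linepath (Complex t a) (Complex t b)) f"
  have split: "?I a c = ?I a b + ?I b c" if "a \<le> b" "b \<le> c" for a b c
    using that
    by (intro contour_integral_split_linepath continuous_on_subset[OF cont] vertical_segment_subset)
      (auto simp: closed_segment_same_Re closed_segment_eq_real_ivl)
  have "?I pi (\<theta> + pi) = ?I (-pi) (\<theta> - pi)"
  proof -
    have "Complex t pi = Complex t (-pi) + 2 * pi * \<i>" "Complex t (\<theta> + pi) = Complex t (\<theta> - pi) + 2 * pi * \<i>"
      by (simp_all add: complex_eq_iff)
    then show ?thesis using per by (simp only: contour_integral_linepath_translate)
  qed
  moreover have "?I (\<theta> - pi) (\<theta> + pi) = ?I (\<theta> - pi) pi + ?I pi (\<theta> + pi)"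
    by (rule split) (use \<theta> in auto)
  moreover have "?I (-pi) pi = ?I (-pi) (\<theta> - pi) + ?I (\<theta> - pi) pi"
    by (rule split) (use \<theta> in auto)
  ultimately show ?thesis by (simp add: vert_integral_def)
qed

text \<open>The Cauchy estimate is applied to translates. Values at two points are both compared
  with the same vertical integral far to the left, which yields a Cauchy criterion with rate
  \<open>exp (Re w / 2)\<close>.\<close>

lemma periodic_limit:
  obtains C where "0 < C"
    "\<And>G K M. (\<And>z. G (z + 2 * pi * \<i>) = G z) \<Longrightarrow>
      (\<And>z. Re z \<le> 0 \<Longrightarrow> dbar_le G z (K * exp (Re z / 2))) \<Longrightarrow>
      (\<And>z. Re z \<le> 0 \<Longrightarrow> cmod (G z) \<le> M * exp (- Re z / 2)) \<Longrightarrow>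
      \<exists>c. \<forall>z. Re z \<le> - 1 \<and> 0 \<le> Im z \<and> Im z \<le> 2 * pi \<longrightarrow> cmod (G z - c) \<le> C * (K + M) * exp (Re z / 2)"
proof -
  obtain C where C: "0 < C" and est:
    "\<And>H \<kappa> \<mu> s \<tau>. (\<And>z. H (z + 2 * pi * \<i>) = H z) \<Longrightarrow>
      (\<And>z. Re z \<le> s \<Longrightarrow> dbar_le H z (\<kappa> * exp (Re z / 2))) \<Longrightarrow>
      (\<And>z. Re z \<le> s \<Longrightarrow> cmod (H z) \<le> \<mu> * exp (- Re z / 2)) \<Longrightarrow> 1 \<le> s \<Longrightarrow> \<tau> \<le> 1 \<Longrightarrow>
      cmod (2 * pi * \<i> * H 0 - vert_integral H \<tau>) \<le> C * (\<kappa> + \<mu> * exp (- s))"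
    using periodic_Cauchy_estimate by blast
  have "\<exists>c. \<forall>z. Re z \<le> - 1 \<and> 0 \<le> Im z \<and> Im z \<le> 2 * pi \<longrightarrow> cmod (G z - c) \<le> C * (K + M) * exp (Re z / 2)"
    if per: "\<And>z. G (z + 2 * pi * \<i>) = G z"
      and dbar: "\<And>z. Re z \<le> 0 \<Longrightarrow> dbar_le G z (K * exp (Re z / 2))"
      and bd: "\<And>z. Re z \<le> 0 \<Longrightarrow> cmod (G z) \<le> M * exp (- Re z / 2)" for G K M
  proof -
    have K: "0 \<le> K" using dbar_le_nonneg[OF dbar[of 0]] by simp
    have M: "0 \<le> M" using order_trans[OF norm_ge_zero bd[of 0]] by simp
    have vert: "cmod (2 * pi * \<i> * G w - vert_integral G \<sigma>) \<le> C * (K + M) * exp (Re w / 2)"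
      if w: "Re w \<le> - 1" "0 \<le> Im w" "Im w \<le> 2 * pi" and \<sigma>: "\<sigma> \<le> Re w" for w \<sigma>
    proof -
      \<comment> \<open>Translation by \<open>w\<close> makes \<open>s = - Re w\<close>,
        \<open>\<kappa> = K * exp (Re w / 2)\<close> and
        \<open>\<mu> = M * exp (- Re w / 2)\<close>. Thus \<open>\<kappa>\<close> and
        \<open>\<mu> * exp (- s)\<close> carry the same factor \<open>exp (Re w / 2)\<close>, and
        \<open>1 \<le> s\<close> is the condition \<open>Re w \<le> - 1\<close>.\<close>
      define H where "H v = G (v + w)" for v
      have "cmod (2 * pi * \<i> * H 0 - vert_integral H (\<sigma> - Re w))
          \<le> C * (K * exp (Re w / 2) + M * exp (- Re w / 2) * exp (- (- Re w)))"
      proof (rule est)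
        fix z assume z: "Re z \<le> - Re w"
        have "dbar_le H z (K * exp (Re (z + w) / 2) * cmod 1)"
          unfolding H_def
          by (rule dbar_le_compose_holomorphic[of G "\<lambda>v. v + w"])
            (use dbar[of "z + w"] z in \<open>auto intro!: derivative_eq_intros\<close>)
        then show "dbar_le H z (K * exp (Re w / 2) * exp (Re z / 2))"
          by (simp add: exp_add add_divide_distrib mult_ac)
        show "cmod (H z) \<le> M * exp (- Re w / 2) * exp (- Re z / 2)"
          using bd[of "z + w"] z by (simp add: H_def exp_add[symmetric] mult.assoc diff_divide_distrib algebra_simps)
      next
        fix z show "H (z + 2 * pi * \<i>) = H z" using per[of "z + w"] by (simp add: H_def add_ac)
      qed (use w \<sigma> in auto)
      moreover have "vert_integral H (\<sigma> - Re w) = vert_integral G \<sigma>"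
      proof -
        have "Complex (\<sigma> - Re w) (-pi) + w = Complex \<sigma> (Im w - pi)"
          "Complex (\<sigma> - Re w) pi + w = Complex \<sigma> (Im w + pi)"
          by (simp_all add: complex_eq_iff)
        then have "vert_integral H (\<sigma> - Re w) =
            contour_integral (linepath (Complex \<sigma> (Im w - pi)) (Complex \<sigma> (Im w + pi))) G"
          unfolding vert_integral_def H_def
          using contour_integral_linepath_translate[of "Complex (\<sigma> - Re w) (-pi)" w "Complex (\<sigma> - Re w) pi" G]
          by simp
        also have "\<dots> = vert_integral G \<sigma>"
        proof (rule vert_integral_shift)
          show "continuous_on {z. Re z = \<sigma>} G"
            by (rule dbar_le_continuous_on[where k = "K * exp (\<sigma> / 2)"]) (use dbar w \<sigma> in force)
        qed (use w per in auto)
        finally show ?thesis .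
      qed
      moreover have "exp (- Re w / 2) * exp (- (- Re w)) = exp (Re w / 2)"
        unfolding exp_add[symmetric] by simp
      ultimately show ?thesis by (simp add: H_def distrib_left distrib_right mult.assoc)
    qed
    have diff: "cmod (G w - G w') \<le> C * (K + M) * exp (Re w / 2)"
      if w: "Re w \<le> - 1" "0 \<le> Im w" "Im w \<le> 2 * pi"
        and w': "Re w' \<le> Re w" "0 \<le> Im w'" "Im w' \<le> 2 * pi" for w w'
    proof -
      define B where "B = C * (K + M) * exp (Re w / 2)"
      have "C * (K + M) * exp (Re w' / 2) \<le> B"
        unfolding B_def using C K M w' by (intro mult_left_mono) auto
      then have "cmod (2 * pi * \<i> * G w - vert_integral G (Re w')) \<le> B"
          "cmod (2 * pi * \<i> * G w' - vert_integral G (Re w')) \<le> B"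
        using vert[of w "Re w'"] vert[of w' "Re w'"] w w' by (auto simp: B_def)
      then have "cmod (2 * pi * \<i> * G w - 2 * pi * \<i> * G w') \<le> 2 * B"
        using norm_triangle_ineq4[of "2 * pi * \<i> * G w - vert_integral G (Re w')"
            "2 * pi * \<i> * G w' - vert_integral G (Re w')"] by simp
      also have "2 * pi * \<i> * G w - 2 * pi * \<i> * G w' = 2 * pi * \<i> * (G w - G w')"
        by (simp add: algebra_simps)
      finally have "pi * cmod (G w - G w') \<le> B" by (simp add: norm_mult)
      moreover have "1 * cmod (G w - G w') \<le> pi * cmod (G w - G w')"
        using pi_ge_two by (intro mult_right_mono) auto
      ultimately show ?thesis by (simp add: B_def)
    qed
    \<comment> \<open>Samples along the negative real axis, starting at \<open>- 1\<close> because
      \<open>diff\<close> holds only from there on; any other point of the strip is then compared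
      with far members.\<close>
    define X where "X n = G (of_real (- 1 - real n))" for n
    have X: "cmod (X m - X n) \<le> C * (K + M) * exp (- (real m / 2))" if "m \<le> n" for m n
    proof -
      have "cmod (X m - X n) \<le> C * (K + M) * exp ((- 1 - real m) / 2)"
        using diff[of "of_real (- 1 - real m)" "of_real (- 1 - real n)"] that by (simp add: X_def)
      also have "\<dots> \<le> C * (K + M) * exp (- (real m / 2))"
        using C K M by (intro mult_left_mono) auto
      finally show ?thesis .
    qed
    have "Cauchy X"
    proof (rule metric_CauchyI)
      fix e :: real assume "0 < e"
      have "(\<lambda>m. exp (- (real m / 2))) \<longlonglongrightarrow> 0" by real_asymp
      then have "(\<lambda>m. C * (K + M) * exp (- (real m / 2))) \<longlonglongrightarrow> C * (K + M) * 0"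
        by (intro tendsto_intros)
      then have "\<forall>\<^sub>F m in sequentially. C * (K + M) * exp (- (real m / 2)) < e / 2"
        by (rule order_tendstoD) (use \<open>0 < e\<close> in simp)
      then obtain m0 where m0: "C * (K + M) * exp (- (real m0 / 2)) < e / 2"
        by (auto simp: eventually_sequentially)
      have "dist (X m) (X n) < e" if "m0 \<le> m" "m0 \<le> n" for m n
        using X[OF that(1)] X[OF that(2)] m0 dist_triangle[of "X m" "X n" "X m0"]
        by (simp add: dist_norm norm_minus_commute)
      then show "\<exists>M. \<forall>m\<ge>M. \<forall>n\<ge>M. dist (X m) (X n) < e" by blast
    qed
    then obtain c where c: "X \<longlonglongrightarrow> c" by (auto simp: Cauchy_convergent_iff convergent_def)
    have "cmod (G w - c) \<le> C * (K + M) * exp (Re w / 2)"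
      if w: "Re w \<le> - 1" "0 \<le> Im w" "Im w \<le> 2 * pi" for w
    proof (rule tendsto_upperbound)
      show "(\<lambda>n. cmod (G w - X n)) \<longlonglongrightarrow> cmod (G w - c)" by (intro tendsto_intros c)
      have "cmod (G w - X n) \<le> C * (K + M) * exp (Re w / 2)" if "nat \<lceil>- Re w\<rceil> \<le> n" for n
        unfolding X_def using that w pi_ge_two by (intro diff) auto
      then show "\<forall>\<^sub>F n in sequentially. cmod (G w - X n) \<le> C * (K + M) * exp (Re w / 2)"
        by (rule eventually_mono[OF eventually_ge_at_top])
    qed simp
    then show ?thesis by blast
  qed
  then show thesis using that C by blast
qed

text \<open>Pull back along \<open>exp\<close> and apply \<open>periodic_limit\<close>;
  \<open>Arg2pi\<close> selects a logarithm in the strip covered there. The constant stands before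
  all other quantifiers, which the finiteness argument relies on.\<close>

lemma punctured_disc_limit:
  "\<exists>C>0. \<forall>\<Phi> K M.
     (\<forall>z. 0 < cmod z \<and> cmod z \<le> 1 \<longrightarrow>
        dbar_le \<Phi> z (K / sqrt (cmod z)) \<and> cmod (\<Phi> z) \<le> M / sqrt (cmod z)) \<longrightarrow>
     (\<exists>c. \<forall>z. 0 < cmod z \<and> cmod z \<le> 1/3 \<longrightarrow> cmod (\<Phi> z - c) \<le> C * (K + M) * sqrt (cmod z))"
proof -
  obtain C where C: "0 < C" and lim:
    "\<And>G K M. (\<And>z. G (z + 2 * pi * \<i>) = G z) \<Longrightarrow>
      (\<And>z. Re z \<le> 0 \<Longrightarrow> dbar_le G z (K * exp (Re z / 2))) \<Longrightarrow>
      (\<And>z. Re z \<le> 0 \<Longrightarrow> cmod (G z) \<le> M * exp (- Re z / 2)) \<Longrightarrow>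
      \<exists>c. \<forall>z. Re z \<le> - 1 \<and> 0 \<le> Im z \<and> Im z \<le> 2 * pi \<longrightarrow> cmod (G z - c) \<le> C * (K + M) * exp (Re z / 2)"
    using periodic_limit by blast
  have sqrt_exp: "sqrt (exp x) = exp (x / 2)" for x
    by (rule real_sqrt_unique) (auto simp: exp_double[symmetric])
  have "\<exists>c. \<forall>z. 0 < cmod z \<and> cmod z \<le> 1/3 \<longrightarrow> cmod (\<Phi> z - c) \<le> C * (K + M) * sqrt (cmod z)"
    if dbar: "\<And>z. 0 < cmod z \<Longrightarrow> cmod z \<le> 1 \<Longrightarrow> dbar_le \<Phi> z (K / sqrt (cmod z))"
      and bd: "\<And>z. 0 < cmod z \<Longrightarrow> cmod z \<le> 1 \<Longrightarrow> cmod (\<Phi> z) \<le> M / sqrt (cmod z)" for \<Phi> K M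
  proof -
    have "\<exists>c. \<forall>z. Re z \<le> - 1 \<and> 0 \<le> Im z \<and> Im z \<le> 2 * pi \<longrightarrow>
        cmod (\<Phi> (exp z) - c) \<le> C * (K + M) * exp (Re z / 2)"
    proof (rule lim)
      fix z :: complex
      have "exp (z + 2 * pi * \<i>) = exp z" by (simp add: exp_add mult_ac)
      then show "\<Phi> (exp (z + 2 * pi * \<i>)) = \<Phi> (exp z)" by simp
    next
      fix z :: complex assume "Re z \<le> 0"
      then have *: "dbar_le \<Phi> (exp z) (K / exp (Re z / 2))" and "cmod (\<Phi> (exp z)) \<le> M / exp (Re z / 2)"
        using dbar[of "exp z"] bd[of "exp z"] by (simp_all add: sqrt_exp)
      moreover have "exp (- Re z / 2) = inverse (exp (Re z / 2))" by (simp add: exp_minus[symmetric])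
      ultimately show "cmod (\<Phi> (exp z)) \<le> M * exp (- Re z / 2)" by (simp only: divide_inverse)
      have "dbar_le (\<lambda>z. \<Phi> (exp z)) z (K / exp (Re z / 2) * cmod (exp z))"
        using * by (rule dbar_le_compose_holomorphic) (rule DERIV_exp)
      also have "K / exp (Re z / 2) * cmod (exp z) = K * exp (Re z / 2)"
      proof -
        have "exp (Re z) = exp (Re z / 2) * exp (Re z / 2)" by (simp add: exp_add[symmetric])
        then show ?thesis by simp
      qed
      finally show "dbar_le (\<lambda>z. \<Phi> (exp z)) z (K * exp (Re z / 2))" .
    qed
    then obtain c where c: "\<And>z. Re z \<le> - 1 \<Longrightarrow> 0 \<le> Im z \<Longrightarrow> Im z \<le> 2 * pi \<Longrightarrow>
        cmod (\<Phi> (exp z) - c) \<le> C * (K + M) * exp (Re z / 2)" by blast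
    have "cmod (\<Phi> z - c) \<le> C * (K + M) * sqrt (cmod z)" if z: "0 < cmod z" "cmod z \<le> 1/3" for z
    proof -
      define w where "w = Complex (ln (cmod z)) (Arg2pi z)"
      have "exp w = of_real (exp (ln (cmod z))) * exp (\<i> * of_real (Arg2pi z))"
        by (simp only: w_def Complex_eq exp_add exp_of_real)
      also have "\<dots> = z" using Arg2pi[of z] z by (simp add: is_Arg_def)
      finally have w: "exp w = z" .
      \<comment> \<open>The radius \<open>1/3\<close> is admissible because
        \<open>exp 1 \<le> 3\<close>, so its logarithm is at most \<open>- 1\<close>.\<close>
      have "ln (cmod z) \<le> ln (exp (-1))"
      proof (subst ln_le_cancel_iff)
        have "inverse (3::real) \<le> inverse (exp 1)" using exp_le by (intro le_imp_inverse_le) auto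
        then show "cmod z \<le> exp (- 1)" using z by (simp add: exp_minus)
      qed (use z in auto)
      then have "cmod (\<Phi> (exp w) - c) \<le> C * (K + M) * exp (Re w / 2)"
        using Arg2pi[of z] by (intro c) (auto simp: w_def)
      moreover have "exp (Re w / 2) = sqrt (cmod z)"
        using z by (simp add: w_def sqrt_exp[symmetric])
      ultimately show ?thesis by (simp add: w)
    qed
    then show ?thesis by blast
  qed
  then show ?thesis using C by (intro exI[of _ C]) simp
qed

lemma punctured_disc_limit_scaled:
  assumes r: "0 < r"
    and dbar: "\<And>z. 0 < cmod z \<Longrightarrow> cmod z \<le> r \<Longrightarrow> dbar_le f z (K / sqrt (cmod z))"
    and bd: "\<And>z. 0 < cmod z \<Longrightarrow> cmod z \<le> r \<Longrightarrow> cmod (f z) \<le> M / sqrt (cmod z)"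
  obtains c C where "\<And>z. 0 < cmod z \<Longrightarrow> cmod z \<le> r / 3 \<Longrightarrow> cmod (f z - c) \<le> C * sqrt (cmod z)"
proof -
  obtain C where lim: "\<And>\<Phi> K M.
      \<forall>z. 0 < cmod z \<and> cmod z \<le> 1 \<longrightarrow>
        dbar_le \<Phi> z (K / sqrt (cmod z)) \<and> cmod (\<Phi> z) \<le> M / sqrt (cmod z) \<Longrightarrow>
      \<exists>c. \<forall>z. 0 < cmod z \<and> cmod z \<le> 1/3 \<longrightarrow> cmod (\<Phi> z - c) \<le> C * (K + M) * sqrt (cmod z)"
    using punctured_disc_limit by metis
  \<comment> \<open>Substituting \<open>r * z\<close> gives a chain rule factor \<open>r\<close> for
    the derivative bound, and \<open>1 / sqrt r\<close> for both weights.\<close>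
  define K' M' where "K' = K * r / sqrt r" and "M' = M / sqrt r"
  have "\<exists>c. \<forall>z. 0 < cmod z \<and> cmod z \<le> 1/3 \<longrightarrow> cmod (f (of_real r * z) - c) \<le> C * (K' + M') * sqrt (cmod z)"
  proof (rule lim, intro allI impI conjI; elim conjE)
    fix z assume z: "0 < cmod z" "cmod z \<le> 1"
    have z': "0 < cmod (of_real r * z)" "cmod (of_real r * z) \<le> r" using z r by (auto simp: norm_mult mult_left_le)
    have "dbar_le (\<lambda>z. f (of_real r * z)) z (K / sqrt (cmod (of_real r * z)) * cmod (of_real r))"
      by (rule dbar_le_compose_holomorphic[of f "\<lambda>z. of_real r * z"])
        (rule dbar[OF z'], auto intro!: derivative_eq_intros)
    then show "dbar_le (\<lambda>z. f (of_real r * z)) z (K' / sqrt (cmod z))"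
      using r by (simp add: K'_def norm_mult real_sqrt_mult mult_ac)
    show "cmod (f (of_real r * z)) \<le> M' / sqrt (cmod z)"
      using bd[OF z'] r by (simp add: M'_def norm_mult real_sqrt_mult)
  qed
  then obtain c where c: "\<And>z. 0 < cmod z \<Longrightarrow> cmod z \<le> 1/3 \<Longrightarrow>
      cmod (f (of_real r * z) - c) \<le> C * (K' + M') * sqrt (cmod z)" by blast
  have "cmod (f z - c) \<le> (C * (K' + M') / sqrt r) * sqrt (cmod z)" if "0 < cmod z" "cmod z \<le> r / 3" for z
    using c[of "z / r"] that r by (simp add: norm_divide real_sqrt_divide field_simps)
  then show thesis by (rule that)
qed

text \<open>On a disc of radius at most 1 a nonnegative constant is bounded by itself divided by
  \<open>sqrt (cmod z)\<close>, so bounded data are a case of the weighted estimate.\<close>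

lemma removable_singularity_dbar:
  assumes r: "0 < r"
    and f: "\<And>z. 0 < cmod z \<Longrightarrow> cmod z \<le> r \<Longrightarrow> \<exists>A. (f has_derivative (\<lambda>h. A * h + g z * cnj h)) (at z)"
    and bd: "\<And>z. 0 < cmod z \<Longrightarrow> cmod z \<le> r \<Longrightarrow> cmod (f z) \<le> M"
    and g: "\<And>z. 0 < cmod z \<Longrightarrow> cmod z \<le> r \<Longrightarrow> cmod (g z) \<le> K"
  obtains c C \<rho> where "0 < \<rho>" "\<rho> \<le> r" "\<rho> \<le> 1" "0 \<le> C"
    "\<And>z. 0 < cmod z \<Longrightarrow> cmod z \<le> \<rho> \<Longrightarrow> cmod (f z - c) \<le> C * sqrt (cmod z)"
proof -
  define s where "s = min r 1"
  have s: "0 < s" "s \<le> r" "s \<le> 1" using r by (auto simp: s_def)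
  have le: "x \<le> x / sqrt (cmod z)" if "0 < cmod z" "cmod z \<le> 1" "0 \<le> x" for x z
    using that mult_left_mono[of "sqrt (cmod z)" 1 x] by (simp add: field_simps)
  have "K \<ge> 0" "M \<ge> 0"
    using order_trans[OF norm_ge_zero g[of "of_real s"]] order_trans[OF norm_ge_zero bd[of "of_real s"]] s
    by auto
  obtain c C where c: "\<And>z. 0 < cmod z \<Longrightarrow> cmod z \<le> s / 3 \<Longrightarrow> cmod (f z - c) \<le> C * sqrt (cmod z)"
  proof (rule punctured_disc_limit_scaled)
    show "0 < s" by fact
    fix z assume z: "0 < cmod z" "cmod z \<le> s"
    show "dbar_le f z (K / sqrt (cmod z))"
    proof -
      obtain A where "(f has_derivative (\<lambda>h. A * h + g z * cnj h)) (at z)" using f[of z] z s by auto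
      then show ?thesis
        by (rule dbar_leI) (use g[of z] le[of z K] z s \<open>K \<ge> 0\<close> in linarith)
    qed
    show "cmod (f z) \<le> M / sqrt (cmod z)"
      using bd[of z] le[of z M] z s \<open>M \<ge> 0\<close> by linarith
  qed blast
  show thesis
  proof (rule that[of "s / 3" "max C 0" c])
    fix z assume z: "0 < cmod z" "cmod z \<le> s / 3"
    have "C * sqrt (cmod z) \<le> max C 0 * sqrt (cmod z)" by (intro mult_right_mono) auto
    then show "cmod (f z - c) \<le> max C 0 * sqrt (cmod z)" using c[OF z] by linarith
  qed (use s in auto)
qed

text \<open>With \<open>c\<close> the limit of \<open>f\<close> at \<open>0\<close>, the quotient \<open>(f z - c - b cnj z) / z\<close> satisfies
  the assumptions of \<open>punctured_disc_limit_scaled\<close> again; its limit is the remaining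
  coefficient of the derivative at \<open>0\<close>.\<close>

lemma extension_has_derivative_dbar:
  assumes r: "0 < r" "r \<le> 1"
    and f: "\<And>z. 0 < cmod z \<Longrightarrow> cmod z \<le> r \<Longrightarrow> \<exists>A. (f has_derivative (\<lambda>h. A * h + g z * cnj h)) (at z)"
    and c: "\<And>z. 0 < cmod z \<Longrightarrow> cmod z \<le> r \<Longrightarrow> cmod (f z - f 0) \<le> C * sqrt (cmod z)"
    and g: "\<And>z. 0 < cmod z \<Longrightarrow> cmod z \<le> r \<Longrightarrow> cmod (g z - b) \<le> L * sqrt (cmod z)"
  obtains A where "(f has_derivative (\<lambda>h. A * h + b * cnj h)) (at 0)"
proof -
  define F where "F z = (f z - f 0 - b * cnj z) * inverse z" for z
  have sq: "sqrt (cmod z) * cmod (inverse z) = 1 / sqrt (cmod z)" if "0 < cmod z" for z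
    using sqrt_divide_self_eq[of "cmod z"] by (simp add: norm_inverse divide_inverse)
  have le1: "cmod z \<le> sqrt (cmod z)" if "0 < cmod z" "cmod z \<le> r" for z
    by (rule real_le_rsqrt) (use that r in \<open>simp add: power2_eq_square mult_left_le\<close>)
  obtain A C' where A: "\<And>z. 0 < cmod z \<Longrightarrow> cmod z \<le> r / 3 \<Longrightarrow> cmod (F z - A) \<le> C' * sqrt (cmod z)"
  proof (rule punctured_disc_limit_scaled)
    show "0 < r" by fact
    fix z assume z: "0 < cmod z" "cmod z \<le> r"
    obtain A where A: "(f has_derivative (\<lambda>h. A * h + g z * cnj h)) (at z)" using f[OF z] by blast
    have "((\<lambda>z. f z - f 0 - b * cnj z) has_derivative (\<lambda>h. A * h + (g z - b) * cnj h)) (at z)"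
      by (rule has_derivative_eq_rhs[OF has_derivative_diff[OF has_derivative_diff[OF A has_derivative_const]
            has_derivative_mult_right[OF bounded_linear_imp_has_derivative[OF bounded_linear_cnj]]]])
        (simp add: fun_eq_iff algebra_simps)
    then have "dbar_le (\<lambda>z. f z - f 0 - b * cnj z) z (L * sqrt (cmod z))"
      by (rule dbar_leI) (rule g[OF z])
    then have "dbar_le F z (L * sqrt (cmod z) * cmod (inverse z))"
      unfolding F_def by (rule dbar_le_mult_holomorphic) (rule DERIV_inverse, use z in auto)
    then show "dbar_le F z (L / sqrt (cmod z))"
      using sq[OF z(1)] by (simp add: mult.assoc)
    have "cmod (f z - f 0 - b * cnj z) \<le> C * sqrt (cmod z) + cmod b * sqrt (cmod z)"
      using norm_triangle_ineq4[of "f z - f 0" "b * cnj z"] c[OF z]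
        mult_left_mono[OF le1[OF z], of "cmod b"] by (simp add: norm_mult)
    then have "cmod (f z - f 0 - b * cnj z) * cmod (inverse z)
        \<le> (C + cmod b) * sqrt (cmod z) * cmod (inverse z)"
      by (intro mult_right_mono) (auto simp: algebra_simps)
    then show "cmod (F z) \<le> (C + cmod b) / sqrt (cmod z)"
      using sq[OF z(1)] by (simp add: F_def norm_mult mult.assoc)
  qed blast
  have "(f has_derivative (\<lambda>h. A * h + b * cnj h)) (at 0)"
    unfolding has_derivative_at_alt
  proof (intro conjI allI impI)
    show "bounded_linear (\<lambda>h. A * h + b * cnj h)"
      by (intro bounded_linear_add bounded_linear_const_mult bounded_linear_mult_right bounded_linear_cnj)
    fix e :: real assume e: "0 < e"
    \<comment> \<open>The maximum keeps the divisor positive, since the sign of \<open>C'\<close> is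
      unknown; the square in \<open>d\<close> inverts the square root in the error bound.\<close>
    define D where "D = max C' 1"
    define d where "d = min (r / 3) ((e / D)\<^sup>2)"
    have "D > 0" by (simp add: D_def)
    have d: "d > 0" using r e \<open>D > 0\<close> by (simp add: d_def)
    have "cmod (f y - f 0 - (A * (y - 0) + b * cnj (y - 0))) \<le> e * cmod (y - 0)" if y: "cmod (y - 0) < d" for y
    proof (cases "y = 0")
      case False
      have "cmod (F y - A) \<le> C' * sqrt (cmod y)" using A[of y] y False by (simp add: d_def)
      also have "\<dots> \<le> D * sqrt (cmod y)" by (intro mult_right_mono) (auto simp: D_def)
      also have "sqrt (cmod y) \<le> e / D"
        by (rule real_le_lsqrt) (use y e \<open>D > 0\<close> in \<open>auto simp: d_def\<close>)
      then have "D * sqrt (cmod y) \<le> e" using \<open>D > 0\<close> by (simp add: field_simps)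
      finally have "cmod (F y - A) * cmod y \<le> e * cmod y" by (rule mult_right_mono) simp
      also have "(F y - A) * y = f y - f 0 - (A * y + b * cnj y)"
        unfolding F_def left_diff_distrib mult.assoc left_inverse[OF False] by simp
      then have "cmod (F y - A) * cmod y = cmod (f y - f 0 - (A * y + b * cnj y))"
        by (simp only: norm_mult[symmetric])
      finally show ?thesis by simp
    qed simp
    then show "\<exists>d>0. \<forall>y. cmod (y - 0) < d \<longrightarrow>
        cmod (f y - f 0 - (A * (y - 0) + b * cnj (y - 0))) \<le> e * cmod (y - 0)"
      using d by blast
  qed
  then show thesis by (rule that)
qed

section \<open>Linear algebra\<close>

text \<open>Induction on \<open>L\<close> with \<open>V\<close> arbitrary. Passing to the kernel of
  one functional loses at most one dimension, restored by any \<open>v\<close> with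
  \<open>l v \<noteq> 0\<close>; with no functionals left, separation forces
  \<open>V = {0}\<close>.\<close>

lemma (in vector_space) finite_span_of_separating_functionals:
  assumes "finite L" "subspace V"
    and add: "\<And>l x y. l \<in> L \<Longrightarrow> l (x + y) = l x + l y"
    and scl: "\<And>l c x. l \<in> L \<Longrightarrow> l (scale c x) = c * l x"
    and sep: "\<And>v. v \<in> V \<Longrightarrow> (\<And>l. l \<in> L \<Longrightarrow> l v = 0) \<Longrightarrow> v = 0"
  shows "\<exists>B. finite B \<and> span B = V"
  using assms
proof (induction L arbitrary: V rule: finite_induct)
  case empty
  then have "V = {0}" using subspace_0 by auto
  then show ?case by (intro exI[of _ "{}"]) simp
next
  case (insert l L)
  have l0: "l 0 = 0" using insert.prems(3)[of l 0 0] by simp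
  define W where "W = {v \<in> V. l v = 0}"
  have "subspace W"
    using insert.prems(1) l0 insert.prems(2)[OF insertI1] insert.prems(3)[OF insertI1]
    by (simp add: subspace_def W_def)
  then have "\<exists>B. finite B \<and> span B = W"
  proof (rule insert.IH)
    fix v assume "v \<in> W" "\<And>l'. l' \<in> L \<Longrightarrow> l' v = 0"
    then show "v = 0" by (intro insert.prems(4)) (auto simp: W_def)
  qed (use insert.prems(2,3) in auto)
  then obtain B where B: "finite B" "span B = W" by blast
  show ?case
  proof (cases "W = V")
    case True
    then show ?thesis using B by blast
  next
    case False
    then obtain v where v: "v \<in> V" "l v \<noteq> 0" by (auto simp: W_def)
    have "span (insert v B) = V"
    proof
      show "span (insert v B) \<subseteq> V"
        using B v span_superset[of B] by (intro span_minimal insert.prems) (auto simp: W_def)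
      show "V \<subseteq> span (insert v B)"
      proof
        fix x assume x: "x \<in> V"
        define y where "y = x + scale (- (l x / l v)) v"
        have "y \<in> V" unfolding y_def
          using insert.prems(1) x v by (intro subspace_add subspace_scale)
        moreover have "l y = 0"
          unfolding y_def insert.prems(2)[OF insertI1] insert.prems(3)[OF insertI1] using v by simp
        ultimately have "x - scale (l x / l v) v \<in> span B"
          by (simp add: B W_def y_def)
        then show "x \<in> span (insert v B)" unfolding span_breakdown_eq by blast
      qed
    qed
    then show ?thesis using B by blast
  qed
qed

text \<open>A quaternionic structure \<open>J\<close>: for \<open>v\<close> outside a \<open>J\<close>-invariant subspace \<open>W\<close>,
  \<open>v\<close> and \<open>J v\<close> are independent modulo \<open>W\<close>, because \<open>J v - k v \<in> W\<close> would give
  \<open>(1 + |k|\<^sup>2) v \<in> W\<close>.\<close>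

lemma even_dim_of_quaternionic_structure:
  fixes scale :: "complex \<Rightarrow> 'b::ab_group_add \<Rightarrow> 'b"
  assumes "vector_space scale" and sub: "module.subspace scale V"
    and B0: "finite B0" "V \<subseteq> module.span scale B0"
    and J: "\<And>x y. J (x + y) = J x + J y" "\<And>c x. J (scale c x) = scale (cnj c) (J x)"
      "\<And>x. J (J x) = - x" "\<And>x. x \<in> V \<Longrightarrow> J x \<in> V"
  shows "even (vector_space.dim scale V)"
proof -
  interpret vector_space scale by fact
  \<comment> \<open>Bases under construction: they grow by pairs \<open>v\<close>,
    \<open>J v\<close>, which preserves parity, and their size is bounded by \<open>card B0\<close>,
    so a largest one exists and must span \<open>V\<close>.\<close>
  define P where "P B \<longleftrightarrow> B \<subseteq> V \<and> independent B \<and> finite B \<and> even (card B) \<and> J ` span B \<subseteq> span B" for B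
  have J0: "J 0 = 0" using J(1)[of 0 0] by simp
  have "P {}" by (simp add: P_def J0 independent_empty)
  moreover have "\<forall>B. P B \<longrightarrow> card B \<le> card B0"
    using independent_span_bound[OF B0(1)] B0(2) unfolding P_def by blast
  ultimately obtain B where B: "P B" "\<And>B'. P B' \<Longrightarrow> card B' \<le> card B"
    using ex_has_greatest_nat[of P "{}" card "Suc (card B0)"] by (auto simp: less_Suc_eq_le)
  have "V \<subseteq> span B"
  proof (rule ccontr)
    assume "\<not> V \<subseteq> span B"
    then obtain v where v: "v \<in> V" "v \<notin> span B" by blast
    have Jv: "J v \<notin> span (insert v B)"
    proof
      assume "J v \<in> span (insert v B)"
      then obtain k where k: "J v - scale k v \<in> span B" unfolding span_breakdown_eq by blast
      define w where "w = J v - scale k v"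
      have w: "w \<in> span B" "J w \<in> span B" using k B(1) by (auto simp: P_def w_def)
      have Jv_eq: "J v = w + scale k v" by (simp add: w_def)
      have "- v = J (w + scale k v)" using J(3)[of v] Jv_eq by simp
      also have "\<dots> = J w + scale (cnj k) (J v)" by (simp only: J(1) J(2))
      also have "\<dots> = J w + (scale (cnj k) w + scale (cnj k * k) v)"
        by (simp only: Jv_eq scale_right_distrib scale_scale)
      finally have "J w + (scale (cnj k) w + scale (cnj k * k) v) + v = 0"
        by (metis add.left_inverse)
      then have "scale (1 + cnj k * k) v = - (J w + scale (cnj k) w)"
        unfolding eq_neg_iff_add_eq_0 by (simp add: scale_left_distrib ac_simps)
      moreover have "- (J w + scale (cnj k) w) \<in> span B"
        using w by (intro span_neg span_add span_scale)
      ultimately have "scale (inverse (1 + cnj k * k)) (scale (1 + cnj k * k) v) \<in> span B"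
        by (simp add: span_scale)
      moreover have "1 + cnj k * k \<noteq> 0"
      proof
        assume "1 + cnj k * k = 0"
        then have "Re (1 + cnj k * k) = 0" by simp
        then have "1 + (Re k)\<^sup>2 + (Im k)\<^sup>2 = 0" by (simp add: power2_eq_square)
        then show False using zero_le_power2[of "Re k"] zero_le_power2[of "Im k"] by linarith
      qed
      ultimately show False using v(2) by simp
    qed
    define B' where "B' = insert (J v) (insert v B)"
    have vB: "v \<notin> B" "J v \<notin> insert v B" using v(2) Jv span_superset by blast+
    have "P B'"
      unfolding P_def
    proof (intro conjI)
      show "B' \<subseteq> V" using B(1) v J(4) by (auto simp: B'_def P_def)
      show "independent B'" unfolding B'_def
        using B(1) v(2) Jv by (intro independent_insertI) (auto simp: P_def)
      show "finite B'" "even (card B')" using B(1) vB by (auto simp: B'_def P_def)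
      have "subspace {x. J x \<in> span B'}"
        unfolding subspace_def by (auto simp: J0 J(1,2) span_zero intro: span_add span_scale)
      moreover have "J x \<in> span B'" if "x \<in> B" for x
      proof -
        have "J x \<in> span B" using that B(1) span_base[of x B] by (auto simp: P_def)
        then show ?thesis using span_mono[of B B'] by (auto simp: B'_def)
      qed
      moreover have "J v \<in> span B'" "J (J v) \<in> span B'"
        unfolding J(3) by (auto intro!: span_neg intro: span_base simp: B'_def)
      ultimately have "span B' \<subseteq> {x. J x \<in> span B'}"
        by (intro span_minimal) (auto simp: B'_def)
      then show "J ` span B' \<subseteq> span B'" by auto
    qed
    then have "card B' \<le> card B" by (rule B(2))
    then show False using vB B(1) by (simp add: B'_def P_def)
  qed
  then have "dim V = card B" using B(1) by (intro dim_unique) (auto simp: P_def)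
  then show ?thesis using B(1) by (simp add: P_def)
qed

section \<open>The Dirac equation\<close>

lemma d_z_eqI: "(f has_derivative (\<lambda>h. A * h + B * cnj h)) (at z) \<Longrightarrow> d_z f z = A"
  and d_zbar_eqI: "(f has_derivative (\<lambda>h. A * h + B * cnj h)) (at z) \<Longrightarrow> d_zbar f z = B"
  by (simp_all add: d_z_def d_zbar_def frechet_derivative_at[symmetric] algebra_simps)

lemma has_derivative_wirtinger:
  assumes "f differentiable (at z)"
  shows "(f has_derivative (\<lambda>h. d_z f z * h + d_zbar f z * cnj h)) (at z)"
proof -
  let ?D = "frechet_derivative f (at z)"
  have D: "(f has_derivative ?D) (at z)" using assms frechet_derivative_works by blast
  then have lin: "linear ?D" by (rule has_derivative_linear)
  have "?D h = d_z f z * h + d_zbar f z * cnj h" for h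
  proof -
    have "?D h = ?D (Re h *\<^sub>R 1 + Im h *\<^sub>R \<i>)" by (simp add: complex_eq[symmetric] scaleR_conv_of_real mult.commute)
    also have "\<dots> = Re h *\<^sub>R ?D 1 + Im h *\<^sub>R ?D \<i>"
      by (simp add: linear_add[OF lin] linear_scale[OF lin])
    also have "\<dots> = d_z f z * h + d_zbar f z * cnj h"
      by (simp add: d_z_def d_zbar_def complex_eq_iff field_simps)
    finally show ?thesis .
  qed
  then show ?thesis by (intro has_derivative_eq_rhs[OF D] ext)
qed

lemma has_derivative_cnj_wirtinger:
  assumes "(f has_derivative (\<lambda>h. A * h + B * cnj h)) (at z)"
  shows "((\<lambda>w. cnj (f w)) has_derivative (\<lambda>h. cnj B * h + cnj A * cnj h)) (at z)"
  by (rule has_derivative_eq_rhs[OF bounded_linear.has_derivative[OF bounded_linear_cnj assms]])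
    (simp add: fun_eq_iff)

lemma differentiable_vec2_iff:
  fixes \<psi> :: "complex \<Rightarrow> complex^2"
  shows "\<psi> differentiable (at z) \<longleftrightarrow>
    (\<lambda>w. \<psi> w $ 1) differentiable (at z) \<and> (\<lambda>w. \<psi> w $ 2) differentiable (at z)"
proof safe
  assume "\<psi> differentiable (at z)"
  then show "(\<lambda>w. \<psi> w $ 1) differentiable (at z)" "(\<lambda>w. \<psi> w $ 2) differentiable (at z)"
    by (auto simp: differentiable_def intro: bounded_linear.has_derivative[OF bounded_linear_vec_nth])
next
  assume d: "(\<lambda>w. \<psi> w $ 1) differentiable (at z)" "(\<lambda>w. \<psi> w $ 2) differentiable (at z)"
  have bl: "bounded_linear (axis i :: complex \<Rightarrow> complex^2)" for i
    by (simp add: linear_conv_bounded_linear[symmetric] linear_iff vec_eq_iff axis_def)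
  have "(\<lambda>w. axis (1::2) (\<psi> w $ 1) + axis (2::2) (\<psi> w $ 2)) differentiable (at z)"
  proof -
    obtain D1 D2 where "((\<lambda>w. \<psi> w $ 1) has_derivative D1) (at z)" "((\<lambda>w. \<psi> w $ 2) has_derivative D2) (at z)"
      using d unfolding differentiable_def by blast
    then show ?thesis
      unfolding differentiable_def
      using has_derivative_add bounded_linear.has_derivative[OF bl] by blast
  qed
  moreover have "axis (1::2) (\<psi> w $ 1) + axis (2::2) (\<psi> w $ 2) = \<psi> w" for w
    by (simp add: vec_eq_iff axis_def forall_2)
  ultimately show "\<psi> differentiable (at z)" by simp
qed

text \<open>In terms of \<open>f = \<psi>\<^sub>1\<close> and \<open>g = cnj \<psi>\<^sub>2\<close> both components of the Dirac equation
  prescribe a \<open>\<partial>/\<partial>cnj z\<close> derivative, and the transition rules for \<open>f\<close> and \<open>g\<close> agree.\<close>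

definition dirac_pair :: "(complex \<Rightarrow> real) \<Rightarrow> (complex \<Rightarrow> complex) \<Rightarrow> (complex \<Rightarrow> complex) \<Rightarrow> complex \<Rightarrow> bool"
  where "dirac_pair U f g z \<longleftrightarrow>
    (\<exists>A. (f has_derivative (\<lambda>h. A * h + of_real (U z) * cnj (g z) * cnj h)) (at z)) \<and>
    (\<exists>A. (g has_derivative (\<lambda>h. A * h + - of_real (U z) * cnj (f z) * cnj h)) (at z))"

lemma dirac_components:
  "dirac U \<psi> z $ 1 = d_z (\<lambda>w. \<psi> w $ 2) z + U z * \<psi> z $ 1"
  "dirac U \<psi> z $ 2 = - d_zbar (\<lambda>w. \<psi> w $ 1) z + U z * \<psi> z $ 2"
  by (simp_all add: dirac_def)

text \<open>Conjugation turns the \<open>z\<close>-derivative of the second component into the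
  conjugate derivative of \<open>g\<close>. As \<open>U z\<close> is real, the first row becomes the
  condition on \<open>g\<close> and the second row the condition on \<open>f\<close>.\<close>

lemma dirac_pair_iff:
  "dirac_pair U (\<lambda>w. \<psi> w $ 1) (\<lambda>w. cnj (\<psi> w $ 2)) z \<longleftrightarrow> \<psi> differentiable (at z) \<and> dirac U \<psi> z = 0"
proof safe
  assume "dirac_pair U (\<lambda>w. \<psi> w $ 1) (\<lambda>w. cnj (\<psi> w $ 2)) z"
  then obtain A B where A: "((\<lambda>w. \<psi> w $ 1) has_derivative (\<lambda>h. A * h + of_real (U z) * \<psi> z $ 2 * cnj h)) (at z)"
    and B: "((\<lambda>w. cnj (\<psi> w $ 2)) has_derivative (\<lambda>h. B * h + - of_real (U z) * cnj (\<psi> z $ 1) * cnj h)) (at z)"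
    unfolding dirac_pair_def by auto
  have B': "((\<lambda>w. \<psi> w $ 2) has_derivative (\<lambda>h. (- of_real (U z) * \<psi> z $ 1) * h + cnj B * cnj h)) (at z)"
    using has_derivative_cnj_wirtinger[OF B] by simp
  show "\<psi> differentiable (at z)"
    unfolding differentiable_vec2_iff using A B' by (auto simp: differentiable_def)
  show "dirac U \<psi> z = 0"
    using d_zbar_eqI[OF A] d_z_eqI[OF B'] by (simp add: vec_eq_iff forall_2 dirac_components)
next
  assume "\<psi> differentiable (at z)" and D: "dirac U \<psi> z = 0"
  then have d: "(\<lambda>w. \<psi> w $ 1) differentiable (at z)" "(\<lambda>w. \<psi> w $ 2) differentiable (at z)"
    unfolding differentiable_vec2_iff by auto
  have "d_z (\<lambda>w. \<psi> w $ 2) z = - of_real (U z) * \<psi> z $ 1" "d_zbar (\<lambda>w. \<psi> w $ 1) z = of_real (U z) * \<psi> z $ 2"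
    using dirac_components[of U \<psi> z] unfolding D by (simp_all add: eq_neg_iff_add_eq_0)
  then show "dirac_pair U (\<lambda>w. \<psi> w $ 1) (\<lambda>w. cnj (\<psi> w $ 2)) z"
    using has_derivative_wirtinger[OF d(1)] has_derivative_cnj_wirtinger[OF has_derivative_wirtinger[OF d(2)]]
    by (auto simp: dirac_pair_def)
qed

text \<open>Here \<open>f' u = (- 1 / u) * f (- 1 / u)\<close>, and \<open>- 1 / u\<close> has
  derivative \<open>z\<^sup>2\<close>. The holomorphic prefactor multiplies the antilinear
  coefficient by \<open>z\<close>, the chain rule by \<open>(cnj z)\<^sup>2\<close>.\<close>

lemma chart_change_has_derivative:
  assumes f: "(f has_derivative (\<lambda>h. A * h + B * cnj h)) (at z)" and z: "z \<noteq> 0"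
    and f': "\<And>w. w \<noteq> 0 \<Longrightarrow> f' (- 1 / w) = w * f w"
  shows "\<exists>A'. (f' has_derivative (\<lambda>h. A' * h + (z * (cnj z)\<^sup>2 * B) * cnj h)) (at (- 1 / z))"
proof -
  define u where "u = - 1 / z"
  have u: "u \<noteq> 0" "z = - 1 / u" using z by (auto simp: u_def)
  have z2: "1 / u\<^sup>2 = z\<^sup>2" using z by (simp add: u_def power2_eq_square)
  have m: "((\<lambda>v. - 1 / v) has_field_derivative z\<^sup>2) (at u)"
    unfolding z2[symmetric] using u by (auto intro!: derivative_eq_intros simp: power2_eq_square)
  have "((\<lambda>v. f (- 1 / v)) has_derivative (\<lambda>h. A * (z\<^sup>2 * h) + B * cnj (z\<^sup>2 * h))) (at u)"
    by (rule has_derivative_compose[of "\<lambda>v. - 1 / v" "\<lambda>h. z\<^sup>2 * h"])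
      (use m f u(2) in \<open>simp_all add: has_field_derivative_def\<close>)
  then have "((\<lambda>v. (- 1 / v) * f (- 1 / v)) has_derivative
      (\<lambda>h. (- 1 / u) * (A * (z\<^sup>2 * h) + B * cnj (z\<^sup>2 * h)) + z\<^sup>2 * h * f (- 1 / u))) (at u)"
    by (rule has_derivative_mult[rotated]) (use m in \<open>simp add: has_field_derivative_def\<close>)
  then have "((\<lambda>v. (- 1 / v) * f (- 1 / v)) has_derivative
      (\<lambda>h. (z * A * z\<^sup>2 + z\<^sup>2 * f z) * h + (z * (cnj z)\<^sup>2 * B) * cnj h)) (at u)"
    unfolding u(2)[symmetric] by (rule has_derivative_eq_rhs) (simp add: fun_eq_iff algebra_simps)
  then have "(f' has_derivative (\<lambda>h. (z * A * z\<^sup>2 + z\<^sup>2 * f z) * h + (z * (cnj z)\<^sup>2 * B) * cnj h)) (at u)"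
  proof (rule has_derivative_transform_within_open)
    show "open (- {0::complex})" "u \<in> - {0}" using u by auto
    fix v :: complex assume "v \<in> - {0}"
    then show "(- 1 / v) * f (- 1 / v) = f' v" using f'[of "- 1 / v"] by simp
  qed
  then show ?thesis unfolding u_def by blast
qed

text \<open>The coefficient \<open>z * (cnj z)\<^sup>2\<close> and its conjugate are
  \<open>\<bar>z\<bar>\<^sup>2\<close> times \<open>cnj z\<close> and \<open>z\<close>. The
  potential terms acquire the same factors, one part from \<open>U'\<close> and the other from the
  transition rule, so both rows scale as a whole.\<close>

lemma dirac_chart_change:
  assumes sec: "(\<psi>, \<psi>') \<in> spinor_sections" and z: "z \<noteq> 0" and d: "\<psi> differentiable (at z)"
    and U: "U' (- 1 / z) = (cmod z)\<^sup>2 * U z"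
  shows "\<psi>' differentiable (at (- 1 / z))"
    and "dirac U' \<psi>' (- 1 / z) =
      (cmod z)\<^sup>2 *\<^sub>R ((vector [vector [z, 0], vector [0, cnj z]] :: complex^2^2) *v dirac U \<psi> z)"
proof -
  let ?u = "- 1 / z"
  have sec': "\<psi>' (- 1 / w) $ 1 = w * \<psi> w $ 1" "\<psi>' (- 1 / w) $ 2 = cnj w * \<psi> w $ 2" if "w \<noteq> 0" for w
    using sec that by (auto simp: spinor_sections_def)
  have d': "(\<lambda>w. \<psi> w $ 1) differentiable (at z)" "(\<lambda>w. \<psi> w $ 2) differentiable (at z)"
    using d unfolding differentiable_vec2_iff by auto
  obtain A where A: "((\<lambda>w. \<psi>' w $ 1) has_derivative
      (\<lambda>h. A * h + (z * (cnj z)\<^sup>2 * d_zbar (\<lambda>w. \<psi> w $ 1) z) * cnj h)) (at ?u)"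
    using chart_change_has_derivative[OF has_derivative_wirtinger[OF d'(1)] z, of "\<lambda>w. \<psi>' w $ 1"] sec' by blast
  obtain B where "((\<lambda>w. cnj (\<psi>' w $ 2)) has_derivative
      (\<lambda>h. B * h + (z * (cnj z)\<^sup>2 * cnj (d_z (\<lambda>w. \<psi> w $ 2) z)) * cnj h)) (at ?u)"
    using chart_change_has_derivative[OF has_derivative_cnj_wirtinger[OF has_derivative_wirtinger[OF d'(2)]] z,
        of "\<lambda>w. cnj (\<psi>' w $ 2)"] sec' by auto
  from has_derivative_cnj_wirtinger[OF this]
  have B: "((\<lambda>w. \<psi>' w $ 2) has_derivative
      (\<lambda>h. (cnj z * z\<^sup>2 * d_z (\<lambda>w. \<psi> w $ 2) z) * h + cnj B * cnj h)) (at ?u)" by simp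
  show "\<psi>' differentiable (at ?u)"
    unfolding differentiable_vec2_iff using A B by (auto simp: differentiable_def)
  have norm2: "complex_of_real ((cmod z)\<^sup>2) = z * cnj z" by (rule complex_norm_square)
  have "dirac U' \<psi>' ?u $ 1 = z * cnj z * (z * dirac U \<psi> z $ 1)"
    unfolding dirac_components d_z_eqI[OF B] sec'[OF z] U of_real_mult norm2
    by (simp add: algebra_simps power2_eq_square)
  moreover have "dirac U' \<psi>' ?u $ 2 = z * cnj z * (cnj z * dirac U \<psi> z $ 2)"
    unfolding dirac_components d_zbar_eqI[OF A] sec'[OF z] U of_real_mult norm2
    by (simp add: algebra_simps power2_eq_square)
  ultimately show "dirac U' \<psi>' ?u =
      (cmod z)\<^sup>2 *\<^sub>R ((vector [vector [z, 0], vector [0, cnj z]] :: complex^2^2) *v dirac U \<psi> z)"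
    by (simp add: vec_eq_iff forall_2 matrix_vector_mult_def sum_2 scaleR_conv_of_real[where 'a = complex] norm2
        del: of_real_power)
qed

section \<open>The kernel\<close>

text \<open>The estimate for punctured discs is used at a regular point \<open>p\<close>, where
  continuity identifies the limit with \<open>f p\<close>. The choice of \<open>C\<close> before
  \<open>f\<close> and \<open>p\<close> makes one net serve all eigenfunctions.\<close>

lemma Hoelder_estimate_dbar:
  "\<exists>C>0. \<forall>f K M p. (\<forall>z. cmod (z - p) \<le> 1 \<longrightarrow> dbar_le f z K \<and> cmod (f z) \<le> M) \<longrightarrow>
     (\<forall>z. cmod (z - p) \<le> 1/3 \<longrightarrow> cmod (f z - f p) \<le> C * (K + M) * sqrt (cmod (z - p)))"
proof -
  obtain C where C: "0 < C" and lim: "\<And>\<Phi> K M.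
      \<forall>z. 0 < cmod z \<and> cmod z \<le> 1 \<longrightarrow>
        dbar_le \<Phi> z (K / sqrt (cmod z)) \<and> cmod (\<Phi> z) \<le> M / sqrt (cmod z) \<Longrightarrow>
      \<exists>c. \<forall>z. 0 < cmod z \<and> cmod z \<le> 1/3 \<longrightarrow> cmod (\<Phi> z - c) \<le> C * (K + M) * sqrt (cmod z)"
    using punctured_disc_limit by metis
  have "cmod (f z - f p) \<le> C * (K + M) * sqrt (cmod (z - p))"
    if f: "\<forall>z. cmod (z - p) \<le> 1 \<longrightarrow> dbar_le f z K \<and> cmod (f z) \<le> M" and z: "cmod (z - p) \<le> 1/3"
    for f K M p z
  proof -
    have K: "0 \<le> K" using dbar_le_nonneg f[rule_format, of p] by auto
    have M: "0 \<le> M" using order_trans[OF norm_ge_zero] f[rule_format, of p] by auto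
    have le: "x \<le> x / sqrt (cmod w)" if "0 < cmod w" "cmod w \<le> 1" "0 \<le> x" for x w
      using that mult_left_mono[of "sqrt (cmod w)" 1 x] by (simp add: field_simps)
    have "\<exists>c. \<forall>w. 0 < cmod w \<and> cmod w \<le> 1/3 \<longrightarrow> cmod (f (w + p) - c) \<le> C * (K + M) * sqrt (cmod w)"
    proof (rule lim, intro allI impI conjI; elim conjE)
      fix w assume w: "0 < cmod w" "cmod w \<le> 1"
      have fw: "dbar_le f (w + p) K" "cmod (f (w + p)) \<le> M" using f w by auto
      have "dbar_le (\<lambda>w. f (w + p)) w (K * cmod 1)"
        by (rule dbar_le_compose_holomorphic[of f "\<lambda>w. w + p"])
          (rule fw, auto intro!: derivative_eq_intros)
      then show "dbar_le (\<lambda>w. f (w + p)) w (K / sqrt (cmod w))"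
        using le[OF w K] by (auto elim: dbar_le_mono)
      show "cmod (f (w + p)) \<le> M / sqrt (cmod w)" using fw(2) le[OF w M] by linarith
    qed
    then obtain c where c: "\<And>w. 0 < cmod w \<Longrightarrow> cmod w \<le> 1/3 \<Longrightarrow>
        cmod (f (w + p) - c) \<le> C * (K + M) * sqrt (cmod w)" by blast
    have "((\<lambda>w. f (w + p) - c) \<longlongrightarrow> 0) (at 0)"
    proof (rule Lim_null_comparison)
      show "\<forall>\<^sub>F w in at 0. cmod (f (w + p) - c) \<le> C * (K + M) * sqrt (cmod w)"
        unfolding eventually_at using c by (intro exI[of _ "1/3"]) auto
      have "((\<lambda>w::complex. C * (K + M) * sqrt (cmod w)) \<longlongrightarrow> C * (K + M) * sqrt (cmod 0)) (at 0)"
        by (intro tendsto_intros)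
      then show "((\<lambda>w::complex. C * (K + M) * sqrt (cmod w)) \<longlongrightarrow> 0) (at 0)" by simp
    qed
    then have "((\<lambda>w. f (w + p)) \<longlongrightarrow> c) (at 0)" by (simp add: Lim_null[symmetric])
    moreover have "((\<lambda>w. f (w + p)) \<longlongrightarrow> f p) (at 0)"
    proof -
      have "isCont f p" using dbar_le_isCont f[rule_format, of p] by auto
      then show ?thesis using LIM_offset_zero[of f "f p" p] by (simp add: isCont_def add.commute)
    qed
    ultimately have "c = f p" using tendsto_unique[OF trivial_limit_at] by blast
    then show ?thesis using c[of "z - p"] z by (cases "z = p") auto
  qed
  then show ?thesis using C by (intro exI[of _ C]) simp
qed

lemma dirac_pair_dbar_le:
  assumes "dirac_pair U f g z" "\<bar>U z\<bar> \<le> \<Lambda>" "cmod (f z) \<le> N" "cmod (g z) \<le> N"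
  shows "dbar_le f z (\<Lambda> * N)" "dbar_le g z (\<Lambda> * N)"
proof -
  have "cmod (of_real (U z) * cnj (g z)) \<le> \<Lambda> * N" "cmod (- of_real (U z) * cnj (f z)) \<le> \<Lambda> * N"
    using assms(2-4) abs_ge_zero[of "U z"] by (auto simp: norm_mult intro!: mult_mono)
  then show "dbar_le f z (\<Lambda> * N)" "dbar_le g z (\<Lambda> * N)"
    using assms(1) unfolding dirac_pair_def by (blast intro: dbar_leI)+
qed

lemma dirac_solution_iff_pair:
  "dirac_solution U \<psi> \<longleftrightarrow> (\<forall>z. dirac_pair U (\<lambda>w. \<psi> w $ 1) (\<lambda>w. cnj (\<psi> w $ 2)) z)"
  by (auto simp: dirac_solution_def dirac_pair_iff)

lemma dirac_pair_zero: "dirac_pair U (\<lambda>w. 0) (\<lambda>w. 0) z"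
  unfolding dirac_pair_def
  by (intro conjI exI[of _ 0]; rule has_derivative_eq_rhs[OF has_derivative_const]; simp)

lemma dirac_pair_add:
  assumes "dirac_pair U f g z" "dirac_pair U f' g' z"
  shows "dirac_pair U (\<lambda>w. f w + f' w) (\<lambda>w. g w + g' w) z"
proof -
  obtain A A' B B' where
    A: "(f has_derivative (\<lambda>h. A * h + of_real (U z) * cnj (g z) * cnj h)) (at z)"
    and B: "(g has_derivative (\<lambda>h. B * h + - of_real (U z) * cnj (f z) * cnj h)) (at z)"
    and A': "(f' has_derivative (\<lambda>h. A' * h + of_real (U z) * cnj (g' z) * cnj h)) (at z)"
    and B': "(g' has_derivative (\<lambda>h. B' * h + - of_real (U z) * cnj (f' z) * cnj h)) (at z)"
    using assms unfolding dirac_pair_def by blast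
  show ?thesis
    unfolding dirac_pair_def
  proof (intro conjI exI)
    show "((\<lambda>w. f w + f' w) has_derivative
        (\<lambda>h. (A + A') * h + of_real (U z) * cnj (g z + g' z) * cnj h)) (at z)"
      by (rule has_derivative_eq_rhs[OF has_derivative_add[OF A A']]) (simp add: fun_eq_iff algebra_simps)
    show "((\<lambda>w. g w + g' w) has_derivative
        (\<lambda>h. (B + B') * h + - of_real (U z) * cnj (f z + f' z) * cnj h)) (at z)"
      by (rule has_derivative_eq_rhs[OF has_derivative_add[OF B B']]) (simp add: fun_eq_iff algebra_simps)
  qed
qed

text \<open>The factor of \<open>g\<close> is conjugated because \<open>g\<close> stands for the
  conjugate of the second spinor component.\<close>

lemma dirac_pair_scale:
  assumes "dirac_pair U f g z"
  shows "dirac_pair U (\<lambda>w. c * f w) (\<lambda>w. cnj c * g w) z"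
proof -
  obtain A B where
    A: "(f has_derivative (\<lambda>h. A * h + of_real (U z) * cnj (g z) * cnj h)) (at z)"
    and B: "(g has_derivative (\<lambda>h. B * h + - of_real (U z) * cnj (f z) * cnj h)) (at z)"
    using assms unfolding dirac_pair_def by blast
  show ?thesis
    unfolding dirac_pair_def
  proof (intro conjI exI)
    show "((\<lambda>w. c * f w) has_derivative (\<lambda>h. (c * A) * h + of_real (U z) * cnj (cnj c * g z) * cnj h)) (at z)"
      by (rule has_derivative_eq_rhs[OF has_derivative_mult_right[OF A]]) (simp add: fun_eq_iff algebra_simps)
    show "((\<lambda>w. cnj c * g w) has_derivative (\<lambda>h. (cnj c * B) * h + - of_real (U z) * cnj (c * f z) * cnj h)) (at z)"
      by (rule has_derivative_eq_rhs[OF has_derivative_mult_right[OF B]]) (simp add: fun_eq_iff algebra_simps)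
  qed
qed

text \<open>The two equations are exchanged, and their opposite signs are absorbed by the minus sign
  of \<open>- g\<close>. The map is linear in \<open>(f, g)\<close> but antilinear in the
  spinor.\<close>

lemma dirac_pair_quaternionic:
  assumes "dirac_pair U f g z"
  shows "dirac_pair U (\<lambda>w. - g w) f z"
proof -
  obtain A B where
    A: "(f has_derivative (\<lambda>h. A * h + of_real (U z) * cnj (g z) * cnj h)) (at z)"
    and B: "(g has_derivative (\<lambda>h. B * h + - of_real (U z) * cnj (f z) * cnj h)) (at z)"
    using assms unfolding dirac_pair_def by blast
  show ?thesis
    unfolding dirac_pair_def
  proof (intro conjI exI)
    show "((\<lambda>w. - g w) has_derivative (\<lambda>h. (- B) * h + of_real (U z) * cnj (f z) * cnj h)) (at z)"
      by (rule has_derivative_eq_rhs[OF has_derivative_minus[OF B]]) (simp add: fun_eq_iff algebra_simps)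
    show "(f has_derivative (\<lambda>h. A * h + - of_real (U z) * cnj (- g z) * cnj h)) (at z)"
      by (rule has_derivative_eq_rhs[OF A]) (simp add: fun_eq_iff)
  qed
qed

lemma subspace_zero_eigenfunctions: "spinors.subspace (zero_eigenfunctions U U')"
proof (rule spinors.subspaceI)
  show "0 \<in> zero_eigenfunctions U U'"
    by (simp add: zero_eigenfunctions_def spinor_sections_def zero_prod_def dirac_solution_iff_pair)
      (intro conjI allI dirac_pair_zero)
next
  fix x y assume "x \<in> zero_eigenfunctions U U'" "y \<in> zero_eigenfunctions U U'"
  then show "x + y \<in> zero_eigenfunctions U U'"
    by (cases x; cases y)
      (auto simp: zero_eigenfunctions_def spinor_sections_def dirac_solution_iff_pair algebra_simps
        intro: dirac_pair_add)
next
  fix c x assume "x \<in> zero_eigenfunctions U U'"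
  then show "spinor_scale c x \<in> zero_eigenfunctions U U'"
    by (cases x)
      (auto simp: zero_eigenfunctions_def spinor_sections_def dirac_solution_iff_pair spinor_scale_def
        intro: dirac_pair_scale)
qed

text \<open>Multiplication by the quaternion unit \<open>j\<close> on the fibres. Conjugation swaps
  the transition factors \<open>z\<close> and \<open>cnj z\<close> together with the components, so
  the same formula works in both charts.\<close>

definition spinor_J :: "spinor_pair \<Rightarrow> spinor_pair" where
  "spinor_J \<Psi> = ((\<lambda>z. vector [- cnj (fst \<Psi> z $ 2), cnj (fst \<Psi> z $ 1)]),
                 (\<lambda>u. vector [- cnj (snd \<Psi> u $ 2), cnj (snd \<Psi> u $ 1)]))"

lemma spinor_J_zero_eigenfunctions:
  assumes "\<Psi> \<in> zero_eigenfunctions U U'"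
  shows "spinor_J \<Psi> \<in> zero_eigenfunctions U U'"
proof (cases \<Psi>)
  case (Pair \<psi> \<psi>')
  then have "(\<psi>, \<psi>') \<in> zero_eigenfunctions U U'" using assms by simp
  then show ?thesis
    using dirac_pair_quaternionic[of U "\<lambda>w. \<psi> w $ 1" "\<lambda>w. cnj (\<psi> w $ 2)"]
      dirac_pair_quaternionic[of U' "\<lambda>w. \<psi>' w $ 1" "\<lambda>w. cnj (\<psi>' w $ 2)"]
    by (auto simp: Pair spinor_J_def zero_eigenfunctions_def spinor_sections_def dirac_solution_iff_pair)
qed

text \<open>The two closed unit discs cover the sphere, and moving from the outside of one into the
  other divides the modulus of a component by a number of modulus at least 1.\<close>

lemma spinor_sections_bound:
  fixes \<psi> \<psi>' :: "complex \<Rightarrow> complex^2"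
  assumes sec: "(\<psi>, \<psi>') \<in> spinor_sections"
    and N: "\<And>z. cmod z \<le> 1 \<Longrightarrow> cmod (\<psi> z $ i) \<le> N" "\<And>z. cmod z \<le> 1 \<Longrightarrow> cmod (\<psi>' z $ i) \<le> N"
    and i: "i = 1 \<or> i = 2"
  shows "cmod (\<psi> z $ i) \<le> N" "cmod (\<psi>' z $ i) \<le> N"
proof -
  have N0: "0 \<le> N" using order_trans[OF norm_ge_zero N(1)[of 0]] by simp
  have eq: "cmod (\<psi>' (- 1 / w) $ i) = cmod w * cmod (\<psi> w $ i)" if "w \<noteq> 0" for w
    using sec that i by (auto simp: spinor_sections_def norm_mult)
  show "cmod (\<psi> z $ i) \<le> N"
  proof (cases "cmod z \<le> 1")
    case False
    then have z: "z \<noteq> 0" "cmod (- 1 / z) \<le> 1" by (auto simp: norm_divide divide_le_eq_1)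
    have "cmod z * cmod (\<psi> z $ i) \<le> N"
      using eq[OF z(1)] N(2)[OF z(2)] by simp
    moreover have "1 * cmod (\<psi> z $ i) \<le> cmod z * cmod (\<psi> z $ i)"
      using False by (intro mult_right_mono) auto
    ultimately show ?thesis by simp
  qed (rule N)
  show "cmod (\<psi>' z $ i) \<le> N"
  proof (cases "cmod z \<le> 1")
    case False
    then have z: "z \<noteq> 0" "cmod (- 1 / z) \<le> 1" by (auto simp: norm_divide divide_le_eq_1)
    then have "cmod (\<psi>' z $ i) = cmod (- 1 / z) * cmod (\<psi> (- 1 / z) $ i)"
      using eq[of "- 1 / z"] by simp
    also have "\<dots> \<le> 1 * N" using z N(1)[OF z(2)] by (intro mult_mono) auto
    finally show ?thesis by simp
  qed (rule N)
qed

lemma dirac_solution_continuous: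
  assumes "dirac_solution U \<psi>"
  shows "isCont \<psi> z"
  using assms differentiable_imp_continuous_within unfolding dirac_solution_def by blast

lemma bounded_on_unit_ball:
  fixes \<psi> :: "complex \<Rightarrow> complex^2"
  assumes "\<And>z. isCont \<psi> z"
  obtains N where "\<And>z i. cmod z \<le> 1 \<Longrightarrow> cmod (\<psi> z $ i) \<le> N"
proof -
  have "compact (\<psi> ` cball 0 1)"
    by (intro compact_continuous_image compact_cball continuous_at_imp_continuous_on ballI assms)
  then have "bounded (\<psi> ` cball 0 1)" by (rule compact_imp_bounded)
  then obtain N where "\<forall>x\<in>\<psi> ` cball 0 1. norm x \<le> N" unfolding bounded_iff by blast
  then have "norm (\<psi> z) \<le> N" if "cmod z \<le> 1" for z using that by simp
  then show thesis by (intro that[of N]) (meson order_trans Finite_Cartesian_Product.norm_nth_le)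
qed

text \<open>By the Hoelder estimate a zero-eigenfunction that vanishes on a sufficiently fine finite net
  of the two closed unit discs is bounded by half of any bound for it, hence vanishes. So finitely
  many point evaluations separate the kernel.\<close>

lemma finite_dim_zero_eigenfunctions:
  assumes U: "continuous_on UNIV U" and U': "continuous_on UNIV U'"
  shows "\<exists>B. finite B \<and> spinors.span B = zero_eigenfunctions U U'"
proof -
  obtain C where C: "0 < C" and Hoelder: "\<And>f K M p z.
      \<forall>z. cmod (z - p) \<le> 1 \<longrightarrow> dbar_le f z K \<and> cmod (f z) \<le> M \<Longrightarrow>
     cmod (z - p) \<le> 1/3 \<Longrightarrow> cmod (f z - f p) \<le> C * (K + M) * sqrt (cmod (z - p))"
    using Hoelder_estimate_dbar by metis
  \<comment> \<open>Radius 2 suffices: the Hoelder estimate looks at distance at most 1 from a net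
    point, which itself lies in the closed unit disc.\<close>
  have bdd: "\<exists>\<Lambda>. \<forall>z. cmod z \<le> 2 \<longrightarrow> \<bar>V z\<bar> \<le> \<Lambda>" if "continuous_on UNIV V" for V :: "complex \<Rightarrow> real"
  proof -
    have "compact (V ` cball 0 2)"
      by (intro compact_continuous_image compact_cball continuous_on_subset[OF that]) simp
    then have "bounded (V ` cball 0 2)" by (rule compact_imp_bounded)
    then obtain N where "\<forall>x\<in>V ` cball 0 2. norm x \<le> N" unfolding bounded_iff by blast
    then show ?thesis by (intro exI[of _ N]) simp
  qed
  obtain \<Lambda>1 \<Lambda>2 where "\<And>z. cmod z \<le> 2 \<Longrightarrow> \<bar>U z\<bar> \<le> \<Lambda>1" "\<And>z. cmod z \<le> 2 \<Longrightarrow> \<bar>U' z\<bar> \<le> \<Lambda>2"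
    using bdd[OF U] bdd[OF U'] by blast
  then obtain \<Lambda> where \<Lambda>: "\<And>z. cmod z \<le> 2 \<Longrightarrow> \<bar>U z\<bar> \<le> \<Lambda>" "\<And>z. cmod z \<le> 2 \<Longrightarrow> \<bar>U' z\<bar> \<le> \<Lambda>"
    by (meson max.coboundedI1 max.coboundedI2)
  have \<Lambda>0: "0 \<le> \<Lambda>" using order_trans[OF abs_ge_zero \<Lambda>(1)[of 0]] by simp
  \<comment> \<open>With sup bound \<open>N\<close> and derivative bound
    \<open>\<Lambda> * N\<close>, the Hoelder bound at distance \<open>\<delta>\<close> is
    \<open>C * (\<Lambda> + 1) * N * sqrt \<delta>\<close>; this choice makes it at most
    \<open>N / 2\<close>.\<close>
  define \<delta> where "\<delta> = min (1/3) ((1 / (2 * (C * (\<Lambda> + 1))))\<^sup>2)"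
  have \<delta>: "0 < \<delta>" "\<delta> \<le> 1/3" using C \<Lambda>0 by (auto simp: \<delta>_def)
  have sqrt\<delta>: "C * (\<Lambda> + 1) * sqrt \<delta> \<le> 1/2"
  proof -
    have "sqrt \<delta> \<le> 1 / (2 * (C * (\<Lambda> + 1)))"
      by (rule real_le_lsqrt) (use C \<Lambda>0 in \<open>auto simp: \<delta>_def\<close>)
    then have "C * (\<Lambda> + 1) * sqrt \<delta> \<le> C * (\<Lambda> + 1) * (1 / (2 * (C * (\<Lambda> + 1))))"
      using C \<Lambda>0 by (intro mult_left_mono) auto
    also have "\<dots> = 1/2"
    proof -
      have "C * (\<Lambda> + 1) \<noteq> 0" using C \<Lambda>0 by simp
      then show ?thesis by (simp only: times_divide_eq_right mult_1_right nonzero_divide_mult_cancel_right mult_divide_mult_cancel_right) simp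
    qed
    finally show ?thesis .
  qed
  obtain P where P: "P \<subseteq> cball 0 1" "finite P" "cball (0::complex) 1 \<subseteq> (\<Union>p\<in>P. ball p \<delta>)"
  proof (rule compactE_image[of "cball (0::complex) 1" "cball 0 1" "\<lambda>p. ball p \<delta>"])
    show "cball (0::complex) 1 \<subseteq> (\<Union>p\<in>cball 0 1. ball p \<delta>)" using \<delta>(1) by force
  qed auto
  have halve: "cmod (f z) \<le> N / 2" "cmod (g z) \<le> N / 2"
    if pair: "\<And>z. dirac_pair V f g z" and V: "\<And>z. cmod z \<le> 2 \<Longrightarrow> \<bar>V z\<bar> \<le> \<Lambda>"
      and N: "\<And>z. cmod (f z) \<le> N" "\<And>z. cmod (g z) \<le> N"
      and P0: "\<And>p. p \<in> P \<Longrightarrow> f p = 0 \<and> g p = 0" and z: "cmod z \<le> 1" for V f g N z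
  proof -
    obtain p where p: "p \<in> P" "cmod (z - p) < \<delta>"
      using P(3) z by (auto simp: dist_norm norm_minus_commute)
    have N0: "0 \<le> N" using order_trans[OF norm_ge_zero N(1)] .
    have near: "dbar_le f w (\<Lambda> * N)" "dbar_le g w (\<Lambda> * N)" if "cmod (w - p) \<le> 1" for w
    proof -
      have "cmod w \<le> 2" using that P(1) p(1) norm_triangle_ineq2[of w p] by force
      then show "dbar_le f w (\<Lambda> * N)" "dbar_le g w (\<Lambda> * N)"
        using dirac_pair_dbar_le[OF pair V N] by auto
    qed
    have "C * (\<Lambda> * N + N) * sqrt (cmod (z - p)) \<le> C * (\<Lambda> * N + N) * sqrt \<delta>"
      using C \<Lambda>0 N0 p by (intro mult_left_mono) auto
    also have "\<dots> = N * (C * (\<Lambda> + 1) * sqrt \<delta>)" by (simp add: algebra_simps)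
    also have "\<dots> \<le> N * (1/2)" using sqrt\<delta> N0 by (rule mult_left_mono)
    finally have le: "C * (\<Lambda> * N + N) * sqrt (cmod (z - p)) \<le> N / 2" by simp
    have zp: "cmod (z - p) \<le> 1/3" using p \<delta> by simp
    have "cmod (f z - f p) \<le> C * (\<Lambda> * N + N) * sqrt (cmod (z - p))"
      "cmod (g z - g p) \<le> C * (\<Lambda> * N + N) * sqrt (cmod (z - p))"
      by (rule Hoelder[OF _ zp], use near N in blast)+
    then show "cmod (f z) \<le> N / 2" "cmod (g z) \<le> N / 2"
      using le P0[OF p(1)] by auto
  qed
  define L :: "(spinor_pair \<Rightarrow> complex) set" where
    "L = (\<Union>p\<in>P. {\<lambda>\<Psi>. fst \<Psi> p $ 1, \<lambda>\<Psi>. fst \<Psi> p $ 2, \<lambda>\<Psi>. snd \<Psi> p $ 1, \<lambda>\<Psi>. snd \<Psi> p $ 2})"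
  show ?thesis
  proof (rule spinors.finite_span_of_separating_functionals[of L])
    show "finite L" using P(2) by (simp add: L_def)
    show "spinors.subspace (zero_eigenfunctions U U')" by (rule subspace_zero_eigenfunctions)
    show "l (x + y) = l x + l y" if "l \<in> L" for l x y
      using that by (auto simp: L_def)
    show "l (spinor_scale c x) = c * l x" if "l \<in> L" for l c x
      using that by (auto simp: L_def spinor_scale_def)
    fix \<Psi> assume \<Psi>: "\<Psi> \<in> zero_eigenfunctions U U'" and van: "\<And>l. l \<in> L \<Longrightarrow> l \<Psi> = 0"
    obtain \<psi> \<psi>' where \<Psi>_eq: "\<Psi> = (\<psi>, \<psi>')" by fastforce
    have sec: "(\<psi>, \<psi>') \<in> spinor_sections" and sol: "dirac_solution U \<psi>" "dirac_solution U' \<psi>'"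
      using \<Psi> by (auto simp: \<Psi>_eq zero_eigenfunctions_def)
    have van': "\<psi> p $ 1 = 0" "\<psi> p $ 2 = 0" "\<psi>' p $ 1 = 0" "\<psi>' p $ 2 = 0" if "p \<in> P" for p
    proof -
      have "(\<lambda>\<Psi>. fst \<Psi> p $ 1) \<in> L" "(\<lambda>\<Psi>. fst \<Psi> p $ 2) \<in> L" "(\<lambda>\<Psi>. snd \<Psi> p $ 1) \<in> L" "(\<lambda>\<Psi>. snd \<Psi> p $ 2) \<in> L"
        using that by (auto simp: L_def)
      from van[OF this(1)] van[OF this(2)] van[OF this(3)] van[OF this(4)]
      show "\<psi> p $ 1 = 0" "\<psi> p $ 2 = 0" "\<psi>' p $ 1 = 0" "\<psi>' p $ 2 = 0" by (simp_all add: \<Psi>_eq)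
    qed
    obtain N1 where N1: "\<And>z i. cmod z \<le> 1 \<Longrightarrow> cmod (\<psi> z $ i) \<le> N1"
      using bounded_on_unit_ball[OF dirac_solution_continuous[OF sol(1)]] by blast
    obtain N2 where N2: "\<And>z i. cmod z \<le> 1 \<Longrightarrow> cmod (\<psi>' z $ i) \<le> N2"
      using bounded_on_unit_ball[OF dirac_solution_continuous[OF sol(2)]] by blast
    define N where "N = max N1 N2"
    have N: "cmod (\<psi> z $ i) \<le> N" "cmod (\<psi>' z $ i) \<le> N" if "cmod z \<le> 1" for z i
      using N1[OF that, of i] N2[OF that, of i] by (auto simp: N_def)
    \<comment> \<open>Both charts are treated at once: a unit disc around a net point leaves the
      closed unit disc, and the bound there comes from the other chart through
      \<open>spinor_sections_bound\<close>.\<close>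
    have small: "cmod (\<psi> z $ i) \<le> N / 2 ^ n \<and> cmod (\<psi>' z $ i) \<le> N / 2 ^ n"
      if "i = 1 \<or> i = 2" "cmod z \<le> 1" for n z i
      using that
    proof (induction n arbitrary: z i)
      case 0 then show ?case using N by simp
    next
      case (Suc n)
      have b: "cmod (\<psi> w $ 1) \<le> N / 2^n" "cmod (\<psi>' w $ 1) \<le> N / 2^n"
          "cmod (\<psi> w $ 2) \<le> N / 2^n" "cmod (\<psi>' w $ 2) \<le> N / 2^n" for w
        by (rule spinor_sections_bound[OF sec]; use Suc.IH in simp)+
      have "cmod (\<psi> z $ 1) \<le> N / 2^n / 2" "cmod (cnj (\<psi> z $ 2)) \<le> N / 2^n / 2"
        by (rule halve[where V = U and f = "\<lambda>w. \<psi> w $ 1" and g = "\<lambda>w. cnj (\<psi> w $ 2)"];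
            use sol(1) \<Lambda>(1) b van' Suc.prems in \<open>auto simp: dirac_solution_iff_pair\<close>)+
      moreover have "cmod (\<psi>' z $ 1) \<le> N / 2^n / 2" "cmod (cnj (\<psi>' z $ 2)) \<le> N / 2^n / 2"
        by (rule halve[where V = U' and f = "\<lambda>w. \<psi>' w $ 1" and g = "\<lambda>w. cnj (\<psi>' w $ 2)"];
            use sol(2) \<Lambda>(2) b van' Suc.prems in \<open>auto simp: dirac_solution_iff_pair\<close>)+
      ultimately show ?case using Suc.prems(1) by (auto simp: mult.commute)
    qed
    have zero: "x \<le> 0" if "\<And>n. x \<le> N / 2 ^ n" for x
    proof (rule LIMSEQ_le_const)
      have "(\<lambda>n. N * (1/2) ^ n) \<longlonglongrightarrow> N * 0" by (intro tendsto_intros LIMSEQ_power_zero) simp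
      then show "(\<lambda>n. N / 2 ^ n) \<longlonglongrightarrow> 0" by (simp add: power_divide)
    qed (use that in blast)
    have "cmod (\<psi> z $ i) \<le> 0" "cmod (\<psi>' z $ i) \<le> 0" if "i = 1 \<or> i = 2" for z i
    proof -
      have b: "cmod (\<psi> w $ i) \<le> 0" "cmod (\<psi>' w $ i) \<le> 0" if "cmod w \<le> 1" for w
        using small[OF \<open>i = 1 \<or> i = 2\<close> that] by (intro zero; simp)+
      show "cmod (\<psi> z $ i) \<le> 0" "cmod (\<psi>' z $ i) \<le> 0"
        by (rule spinor_sections_bound[OF sec _ _ that]; rule b; assumption)+
    qed
    then show "\<Psi> = 0" by (simp add: \<Psi>_eq zero_prod_def fun_eq_iff vec_eq_iff forall_2)
  qed
qed

lemma even_dim_zero_eigenfunctions: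
  assumes "continuous_on UNIV U" "continuous_on UNIV U'"
  shows "even (spinors.dim (zero_eigenfunctions U U'))"
proof -
  obtain B where "finite B" "spinors.span B = zero_eigenfunctions U U'"
    using finite_dim_zero_eigenfunctions[OF assms] by blast
  then show ?thesis
    by (intro even_dim_of_quaternionic_structure[where J = spinor_J and ?B0.0 = B]
        spinors.vector_space_axioms subspace_zero_eigenfunctions spinor_J_zero_eigenfunctions)
      (auto simp: spinor_J_def spinor_scale_def fun_eq_iff vec_eq_iff forall_2 prod_eq_iff)
qed

section \<open>Decaying solutions and the point at infinity\<close>

lemma dirac_pair_cong_near:
  assumes "dirac_pair U f g z" "open S" "z \<in> S" "\<And>w. w \<in> S \<Longrightarrow> f w = f' w" "\<And>w. w \<in> S \<Longrightarrow> g w = g' w"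
  shows "dirac_pair U f' g' z"
proof -
  have eq: "f' z = f z" "g' z = g z" using assms(3-5) by auto
  show ?thesis
    using assms(1) unfolding dirac_pair_def eq
    by (blast intro: has_derivative_transform_within_open[OF _ assms(2,3)] assms(4,5))
qed

text \<open>Two passes. Boundedness first gives limits \<open>a\<close> and \<open>b\<close> with
  error of order \<open>sqrt (cmod z)\<close>. By \<open>lip\<close> the coefficients prescribed by
  the equation then converge at the same rate, which yields differentiability at \<open>0\<close>
  with the antilinear coefficient demanded by the equation there.\<close>

lemma dirac_pair_removable_singularity:
  assumes r: "0 < r" "r \<le> 1"
    and pair: "\<And>z. 0 < cmod z \<Longrightarrow> cmod z \<le> r \<Longrightarrow> dirac_pair V f g z"
    and bd: "\<And>z. 0 < cmod z \<Longrightarrow> cmod z \<le> r \<Longrightarrow> cmod (f z) \<le> M \<and> cmod (g z) \<le> M"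
    and V: "\<And>z. cmod z \<le> r \<Longrightarrow> \<bar>V z\<bar> \<le> \<Lambda>"
    and lip: "\<And>z. cmod z \<le> r \<Longrightarrow> \<bar>V z - V 0\<bar> \<le> D * cmod z"
  obtains a b where "dirac_pair V (f(0 := a)) (g(0 := b)) 0"
proof -
  have f: "\<exists>A. (f has_derivative (\<lambda>h. A * h + of_real (V z) * cnj (g z) * cnj h)) (at z)"
    and g: "\<exists>A. (g has_derivative (\<lambda>h. A * h + - of_real (V z) * cnj (f z) * cnj h)) (at z)"
    if "0 < cmod z" "cmod z \<le> r" for z
    using pair[OF that] unfolding dirac_pair_def by auto
  have bds: "cmod (f z) \<le> M" "cmod (g z) \<le> M" "cmod (of_real (V z) * cnj (g z)) \<le> \<Lambda> * M"
      "cmod (- of_real (V z) * cnj (f z)) \<le> \<Lambda> * M"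
    if "0 < cmod z" "cmod z \<le> r" for z
    using bd[OF that] V[OF that(2)] abs_ge_zero[of "V z"] by (auto simp: norm_mult intro!: mult_mono)
  obtain a C1 \<rho>1 where \<rho>1: "0 < \<rho>1" "\<rho>1 \<le> r" "0 \<le> C1"
    and a: "\<And>z. 0 < cmod z \<Longrightarrow> cmod z \<le> \<rho>1 \<Longrightarrow> cmod (f z - a) \<le> C1 * sqrt (cmod z)"
    using removable_singularity_dbar[OF r(1) f bds(1) bds(3)] by metis
  obtain b C2 \<rho>2 where \<rho>2: "0 < \<rho>2" "\<rho>2 \<le> r" "0 \<le> C2"
    and b: "\<And>z. 0 < cmod z \<Longrightarrow> cmod z \<le> \<rho>2 \<Longrightarrow> cmod (g z - b) \<le> C2 * sqrt (cmod z)"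
    using removable_singularity_dbar[OF r(1) g bds(2) bds(4)] by metis
  define \<rho> where "\<rho> = min \<rho>1 \<rho>2"
  have \<rho>: "0 < \<rho>" "\<rho> \<le> \<rho>1" "\<rho> \<le> \<rho>2" "\<rho> \<le> r" "\<rho> \<le> 1" using \<rho>1 \<rho>2 r by (auto simp: \<rho>_def)
  define F G where "F = f(0 := a)" and "G = g(0 := b)"
  have FG: "F z = f z" "G z = g z" if "0 < cmod z" for z using that by (auto simp: F_def G_def)
  have FG0: "F 0 = a" "G 0 = b" by (auto simp: F_def G_def)
  have \<Lambda>0: "0 \<le> \<Lambda>" using order_trans[OF abs_ge_zero V[of 0]] r by simp
  have D0: "0 \<le> D" using order_trans[OF abs_ge_zero lip[of "of_real r"]] r by (simp add: zero_le_mult_iff)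
  have le1: "cmod z \<le> sqrt (cmod z)" if "cmod z \<le> 1" for z
    by (rule real_le_rsqrt) (use that in \<open>simp add: power2_eq_square mult_left_le\<close>)
  \<comment> \<open>Split into the error of the spinor and the error of the potential; the latter is
    linear in \<open>cmod z\<close>, hence below \<open>sqrt (cmod z)\<close> on a disc of radius at
    most 1.\<close>
  have coeff: "cmod (of_real (V z) * cnj y - of_real (V 0) * cnj c) \<le> (\<Lambda> * C + D * cmod c) * sqrt (cmod z)"
    if z: "0 < cmod z" "cmod z \<le> \<rho>" and y: "cmod (y - c) \<le> C * sqrt (cmod z)" for z y c C
  proof -
    have eq: "of_real (V z) * cnj y - of_real (V 0) * cnj c =
        of_real (V z) * cnj (y - c) + of_real (V z - V 0) * cnj c"
      by (simp add: algebra_simps)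
    have "cmod (of_real (V z) * cnj (y - c)) \<le> \<Lambda> * (C * sqrt (cmod z))"
      using V[of z] y z \<rho> \<Lambda>0 unfolding norm_mult complex_mod_cnj norm_of_real by (intro mult_mono) auto
    moreover have "D * cmod z \<le> D * sqrt (cmod z)"
      using le1[of z] z \<rho> D0 by (intro mult_left_mono) auto
    then have "\<bar>V z - V 0\<bar> \<le> D * sqrt (cmod z)" using lip[of z] z \<rho> by linarith
    then have "cmod (of_real (V z - V 0) * cnj c) \<le> D * sqrt (cmod z) * cmod c"
      unfolding norm_mult complex_mod_cnj norm_of_real by (rule mult_right_mono) simp
    ultimately have "cmod (of_real (V z) * cnj (y - c) + of_real (V z - V 0) * cnj c)
        \<le> \<Lambda> * (C * sqrt (cmod z)) + D * sqrt (cmod z) * cmod c"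
      by (rule norm_triangle_mono)
    then show ?thesis unfolding eq by (simp add: algebra_simps)
  qed
  have op: "open (- {0::complex})" by auto
  obtain A where A: "(F has_derivative (\<lambda>h. A * h + of_real (V 0) * cnj b * cnj h)) (at 0)"
  proof (rule extension_has_derivative_dbar[OF \<rho>(1,5)])
    fix z assume z: "0 < cmod z" "cmod z \<le> \<rho>"
    obtain A' where "(f has_derivative (\<lambda>h. A' * h + of_real (V z) * cnj (g z) * cnj h)) (at z)"
      using f[of z] z \<rho> by auto
    then have "(F has_derivative (\<lambda>h. A' * h + of_real (V z) * cnj (g z) * cnj h)) (at z)"
      by (rule has_derivative_transform_within_open[OF _ op]) (use z FG in auto)
    then show "\<exists>A. (F has_derivative (\<lambda>h. A * h + of_real (V z) * cnj (g z) * cnj h)) (at z)" by blast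
    show "cmod (F z - F 0) \<le> C1 * sqrt (cmod z)" using a[of z] z \<rho> FG FG0 by simp
    show "cmod (of_real (V z) * cnj (g z) - of_real (V 0) * cnj b) \<le> (\<Lambda> * C2 + D * cmod b) * sqrt (cmod z)"
      by (rule coeff[OF z b]) (use z \<rho> in auto)
  qed blast
  obtain B where B: "(G has_derivative (\<lambda>h. B * h + - of_real (V 0) * cnj a * cnj h)) (at 0)"
  proof (rule extension_has_derivative_dbar[OF \<rho>(1,5)])
    fix z assume z: "0 < cmod z" "cmod z \<le> \<rho>"
    obtain A' where "(g has_derivative (\<lambda>h. A' * h + - of_real (V z) * cnj (f z) * cnj h)) (at z)"
      using g[of z] z \<rho> by auto
    then have "(G has_derivative (\<lambda>h. A' * h + - of_real (V z) * cnj (f z) * cnj h)) (at z)"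
      by (rule has_derivative_transform_within_open[OF _ op]) (use z FG in auto)
    then show "\<exists>A. (G has_derivative (\<lambda>h. A * h + - of_real (V z) * cnj (f z) * cnj h)) (at z)" by blast
    show "cmod (G z - G 0) \<le> C2 * sqrt (cmod z)" using b[of z] z \<rho> FG FG0 by simp
    have "cmod (of_real (V z) * cnj (f z) - of_real (V 0) * cnj a) \<le> (\<Lambda> * C1 + D * cmod a) * sqrt (cmod z)"
      by (rule coeff[OF z a]) (use z \<rho> in auto)
    moreover have "- of_real (V z) * cnj (f z) - - of_real (V 0) * cnj a =
        - (of_real (V z) * cnj (f z) - of_real (V 0) * cnj a)" by simp
    ultimately show "cmod (- of_real (V z) * cnj (f z) - - of_real (V 0) * cnj a)
        \<le> (\<Lambda> * C1 + D * cmod a) * sqrt (cmod z)" by (simp only: norm_minus_cancel)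
  qed blast
  have "dirac_pair V F G 0"
    unfolding dirac_pair_def FG0 using A B by blast
  then show thesis by (intro that) (simp add: F_def G_def)
qed

text \<open>The transition rule fixes the second expression away from \<open>u = 0\<close>, and
  continuity fixes it there.\<close>

lemma zero_eigenfunctions_inj: "inj_on fst (zero_eigenfunctions U U')"
proof (rule inj_onI)
  fix x y assume xy: "x \<in> zero_eigenfunctions U U'" "y \<in> zero_eigenfunctions U U'" "fst x = fst y"
  obtain \<psi> \<psi>1 \<psi>2 where eq: "x = (\<psi>, \<psi>1)" "y = (\<psi>, \<psi>2)" using xy(3) by (metis prod.collapse)
  have sec: "(\<psi>, \<psi>1) \<in> spinor_sections" "(\<psi>, \<psi>2) \<in> spinor_sections"
    and sol: "dirac_solution U' \<psi>1" "dirac_solution U' \<psi>2"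
    using xy by (auto simp: eq zero_eigenfunctions_def)
  have off: "\<psi>1 u = \<psi>2 u" if "u \<noteq> 0" for u
  proof -
    have "\<psi>1 (- 1 / w) = \<psi>2 (- 1 / w)" if "w \<noteq> 0" for w
      using sec that by (simp add: spinor_sections_def vec_eq_iff forall_2)
    from this[of "- 1 / u"] show ?thesis using that by simp
  qed
  have "(\<psi>1 \<longlongrightarrow> \<psi>1 0) (at 0)" "(\<psi>2 \<longlongrightarrow> \<psi>2 0) (at 0)"
    using dirac_solution_continuous sol unfolding isCont_def by blast+
  moreover have "(\<psi>1 \<longlongrightarrow> \<psi>2 0) (at 0) \<longleftrightarrow> (\<psi>2 \<longlongrightarrow> \<psi>2 0) (at 0)"
    using off by (intro tendsto_cong) (auto simp: eventually_at intro: exI[of _ 1])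
  ultimately have "\<psi>1 0 = \<psi>2 0" using tendsto_unique[OF trivial_limit_at] by blast
  then have "\<psi>1 = \<psi>2" using off by (metis ext)
  then show "x = y" by (simp add: eq)
qed

text \<open>The second expression is bounded near \<open>u = 0\<close>, and its components at
  \<open>- 1 / z\<close> have modulus \<open>cmod z\<close> times those of
  \<open>\<psi> z\<close>.\<close>

lemma zero_eigenfunction_decay:
  fixes \<psi> \<psi>' :: "complex \<Rightarrow> complex^2"
  assumes "(\<psi>, \<psi>') \<in> zero_eigenfunctions U U'"
  shows "(\<lambda>z. (cmod (\<psi> z $ 1))\<^sup>2 + (cmod (\<psi> z $ 2))\<^sup>2) \<in> O[at_infinity](\<lambda>z. 1 / (cmod z)\<^sup>2)"
proof -
  have sec: "(\<psi>, \<psi>') \<in> spinor_sections" and sol: "dirac_solution U' \<psi>'"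
    using assms by (auto simp: zero_eigenfunctions_def)
  obtain N where N: "\<And>z i. cmod z \<le> 1 \<Longrightarrow> cmod (\<psi>' z $ i) \<le> N"
    using bounded_on_unit_ball[OF dirac_solution_continuous[OF sol]] by blast
  have "norm ((cmod (\<psi> z $ 1))\<^sup>2 + (cmod (\<psi> z $ 2))\<^sup>2) \<le> 2 * N\<^sup>2 * norm (1 / (cmod z)\<^sup>2)" if z: "1 \<le> cmod z" for z
  proof -
    have z': "z \<noteq> 0" "cmod (- 1 / z) \<le> 1" using z by (auto simp: norm_divide divide_le_eq_1)
    have "cmod z * cmod (\<psi> z $ 1) \<le> N" "cmod z * cmod (\<psi> z $ 2) \<le> N"
      using N[OF z'(2), of 1] N[OF z'(2), of 2] sec z'(1) by (auto simp: spinor_sections_def norm_mult)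
    then have "(cmod z * cmod (\<psi> z $ 1))\<^sup>2 \<le> N\<^sup>2" "(cmod z * cmod (\<psi> z $ 2))\<^sup>2 \<le> N\<^sup>2"
      by (auto intro!: power_mono)
    then have "((cmod (\<psi> z $ 1))\<^sup>2 + (cmod (\<psi> z $ 2))\<^sup>2) * (cmod z)\<^sup>2 \<le> 2 * N\<^sup>2"
      by (simp add: power_mult_distrib algebra_simps)
    then show ?thesis using z'(1) by (simp add: field_simps)
  qed
  then show ?thesis
    by (intro bigoI[of _ "2 * N\<^sup>2"]) (auto simp: eventually_at_infinity)
qed

text \<open>In the chart \<open>u\<close> the decay condition says that the transformed spinor is
  bounded near \<open>0\<close>, and the asymptotics of \<open>U\<close> say that \<open>U'\<close>
  is Lipschitz at \<open>0\<close> with value \<open>U_plus\<close>. The singularity is then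
  removable.\<close>

lemma extend_decaying_solution:
  fixes U U' :: "complex \<Rightarrow> real" and \<psi> :: "complex \<Rightarrow> complex^2"
  assumes U': "continuous_on UNIV U'"
    and UU': "\<And>z. z \<noteq> 0 \<Longrightarrow> U' (- 1 / z) = (cmod z)\<^sup>2 * U z"
    and asym: "(\<lambda>z. U z - U_plus / (cmod z)\<^sup>2) \<in> O[at_infinity](\<lambda>z. 1 / (cmod z)^3)"
    and sol: "dirac_solution U \<psi>"
    and decay: "(\<lambda>z. (cmod (\<psi> z $ 1))\<^sup>2 + (cmod (\<psi> z $ 2))\<^sup>2) \<in> O[at_infinity](\<lambda>z. 1 / (cmod z)\<^sup>2)"
  obtains \<psi>' where "(\<psi>, \<psi>') \<in> zero_eigenfunctions U U'"
proof -
  obtain D where D: "0 < D" "\<forall>\<^sub>F z in at_infinity. norm (U z - U_plus / (cmod z)\<^sup>2) \<le> D * norm (1 / (cmod z)^3)"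
    using landau_o.bigE[OF asym] by blast
  obtain E where E: "0 < E" "\<forall>\<^sub>F z in at_infinity.
      norm ((cmod (\<psi> z $ 1))\<^sup>2 + (cmod (\<psi> z $ 2))\<^sup>2) \<le> E * norm (1 / (cmod z)\<^sup>2)"
    using landau_o.bigE[OF decay] by blast
  obtain R where R: "\<And>z. R \<le> cmod z \<Longrightarrow>
      \<bar>U z - U_plus / (cmod z)\<^sup>2\<bar> \<le> D * norm (1 / (cmod z)^3) \<and>
      \<bar>(cmod (\<psi> z $ 1))\<^sup>2 + (cmod (\<psi> z $ 2))\<^sup>2\<bar> \<le> E * norm (1 / (cmod z)\<^sup>2)"
    using eventually_conj[OF D(2) E(2)] unfolding eventually_at_infinity real_norm_def by blast
  \<comment> \<open>Then \<open>cmod u \<le> r\<close> puts \<open>- 1 / u\<close> where the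
    asymptotic bounds hold, and the maximum with 1 ensures \<open>0 < r\<close> and
    \<open>r \<le> 1\<close>.\<close>
  define r where "r = 1 / max R 1"
  have r: "0 < r" "r \<le> 1" by (auto simp: r_def)
  have far: "R \<le> cmod (- 1 / u)" "- 1 / u \<noteq> 0" if "0 < cmod u" "cmod u \<le> r" for u
  proof -
    have "cmod u * max R 1 \<le> 1" using that(2) by (simp add: r_def pos_le_divide_eq)
    then have "max R 1 \<le> 1 / cmod u" using that(1) by (simp only: pos_le_divide_eq mult.commute)
    then show "R \<le> cmod (- 1 / u)" "- 1 / u \<noteq> 0" using that by (auto simp: norm_divide)
  qed
  have U'_off: "\<bar>U' u - U_plus\<bar> \<le> D * cmod u" if u: "0 < cmod u" "cmod u \<le> r" for u
  proof -
    define z where "z = - 1 / u"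
    have z: "R \<le> cmod z" "z \<noteq> 0" "u = - 1 / z" "cmod u = 1 / cmod z"
      using far[OF u] u by (auto simp: z_def norm_divide)
    have "\<bar>U' u - U_plus\<bar> = (cmod z)\<^sup>2 * \<bar>U z - U_plus / (cmod z)\<^sup>2\<bar>"
    proof -
      have "U' u - U_plus = (cmod z)\<^sup>2 * (U z - U_plus / (cmod z)\<^sup>2)"
        unfolding z(3) UU'[OF z(2)] using z(2) by (simp add: right_diff_distrib)
      then show ?thesis by (simp add: abs_mult)
    qed
    also have "\<dots> \<le> (cmod z)\<^sup>2 * (D * norm (1 / (cmod z)^3))"
      using R[OF z(1)] by (intro mult_left_mono) auto
    also have "\<dots> = D * cmod u"
      using z(2) unfolding z(4) by (simp add: power2_eq_square power3_eq_cube)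
    finally show ?thesis .
  qed
  have "U' 0 = U_plus"
  proof -
    have "isCont U' 0" using U' by (simp add: continuous_on_eq_continuous_at)
    then have 1: "(U' \<longlongrightarrow> U' 0) (at 0)" by (simp add: isCont_def)
    have "((\<lambda>u. U' u - U_plus) \<longlongrightarrow> 0) (at 0)"
    proof (rule Lim_null_comparison)
      show "\<forall>\<^sub>F u in at 0. norm (U' u - U_plus) \<le> D * cmod u"
        unfolding eventually_at using U'_off r by (intro exI[of _ r]) auto
      have "((\<lambda>u::complex. D * cmod u) \<longlongrightarrow> D * cmod 0) (at 0)" by (intro tendsto_intros)
      then show "((\<lambda>u::complex. D * cmod u) \<longlongrightarrow> 0) (at 0)" by simp
    qed
    then have "(U' \<longlongrightarrow> U_plus) (at 0)" by (simp add: Lim_null[symmetric])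
    then show ?thesis using 1 tendsto_unique[OF trivial_limit_at] by blast
  qed
  then have lip: "\<bar>U' u - U' 0\<bar> \<le> D * cmod u" if "cmod u \<le> r" for u
    using U'_off[of u] that by (cases "u = 0") auto
  have bdU: "\<bar>U' u\<bar> \<le> \<bar>U' 0\<bar> + D" if "cmod u \<le> r" for u
  proof -
    have "D * cmod u \<le> D * 1" using that r D(1) by (intro mult_left_mono) auto
    then show ?thesis using lip[OF that] by linarith
  qed
  define f g where "f u = (- 1 / u) * \<psi> (- 1 / u) $ 1" and "g u = (- 1 / u) * cnj (\<psi> (- 1 / u) $ 2)" for u
  \<comment> \<open>A provisional second expression: at \<open>u = 0\<close> it is only the default
    value of division by zero, later replaced by the limits \<open>a\<close> and
    \<open>cnj b\<close>.\<close>
  define \<psi>0 :: "complex \<Rightarrow> complex^2" where "\<psi>0 u = vector [f u, cnj (g u)]" for u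
  have \<psi>0: "(\<lambda>u. \<psi>0 u $ 1) = f" "(\<lambda>u. cnj (\<psi>0 u $ 2)) = g" by (auto simp: \<psi>0_def)
  have sec0: "(\<psi>, \<psi>0) \<in> spinor_sections"
    by (auto simp: spinor_sections_def \<psi>0_def f_def g_def)
  have pair: "dirac_pair U' f g u" if "u \<noteq> 0" for u
  proof -
    have z: "- 1 / u \<noteq> 0" "- 1 / (- 1 / u) = u" using that by auto
    have "\<psi> differentiable (at (- 1 / u))" "dirac U \<psi> (- 1 / u) = 0"
      using sol by (auto simp: dirac_solution_def)
    then have "\<psi>0 differentiable (at u)" "dirac U' \<psi>0 u = 0"
      using dirac_chart_change[where U = U and U' = U', OF sec0 z(1)] UU'[OF z(1)] unfolding z(2) by auto
    then show ?thesis using dirac_pair_iff[of U' \<psi>0 u] unfolding \<psi>0 by simp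
  qed
  have bd: "cmod (f u) \<le> sqrt E \<and> cmod (g u) \<le> sqrt E" if u: "0 < cmod u" "cmod u \<le> r" for u
  proof -
    define z where "z = - 1 / u"
    have z: "R \<le> cmod z" "z \<noteq> 0" using far[OF u] by (auto simp: z_def)
    have "(cmod z)\<^sup>2 * ((cmod (\<psi> z $ 1))\<^sup>2 + (cmod (\<psi> z $ 2))\<^sup>2) \<le> E"
      using R[OF z(1)] z(2) by (simp add: field_simps)
    then have "(cmod z * cmod (\<psi> z $ 1))\<^sup>2 + (cmod z * cmod (\<psi> z $ 2))\<^sup>2 \<le> E"
      by (simp add: power_mult_distrib distrib_left)
    then have "(cmod z * cmod (\<psi> z $ 1))\<^sup>2 \<le> E" "(cmod z * cmod (\<psi> z $ 2))\<^sup>2 \<le> E"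
      using zero_le_power2[of "cmod z * cmod (\<psi> z $ 1)"] zero_le_power2[of "cmod z * cmod (\<psi> z $ 2)"]
      by linarith+
    then show ?thesis
      unfolding f_def g_def z_def[symmetric] norm_mult complex_mod_cnj by (auto intro: real_le_rsqrt)
  qed
  obtain a b where ab: "dirac_pair U' (f(0 := a)) (g(0 := b)) 0"
  proof (rule dirac_pair_removable_singularity[OF r _ bd bdU lip])
    show "dirac_pair U' f g u" if "0 < cmod u" "cmod u \<le> r" for u using pair[of u] that by simp
  qed
  define \<psi>' :: "complex \<Rightarrow> complex^2" where "\<psi>' u = vector [(f(0 := a)) u, cnj ((g(0 := b)) u)]" for u
  have \<psi>': "(\<lambda>u. \<psi>' u $ 1) = f(0 := a)" "(\<lambda>u. cnj (\<psi>' u $ 2)) = g(0 := b)" by (auto simp: \<psi>'_def)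
  have "dirac_pair U' (f(0 := a)) (g(0 := b)) u" for u
  proof (cases "u = 0")
    case False
    then show ?thesis
      by (intro dirac_pair_cong_near[OF pair[OF False], of "- {0}"]) auto
  qed (use ab in simp)
  then have "dirac_solution U' \<psi>'" unfolding dirac_solution_iff_pair \<psi>' by blast
  moreover have "(\<psi>, \<psi>') \<in> spinor_sections"
    by (auto simp: spinor_sections_def \<psi>'_def f_def g_def)
  ultimately show thesis using sol by (intro that) (simp add: zero_eigenfunctions_def)
qed

theorem theorem3:
  fixes U U' :: "complex \<Rightarrow> real" and U_plus :: real
  assumes "continuous_on UNIV U" and "continuous_on UNIV U'"
    and "\<And>z. z \<noteq> 0 \<Longrightarrow> U' (- 1 / z) = (cmod z)\<^sup>2 * U z"
    and "(\<lambda>z. U z - U_plus / (cmod z)\<^sup>2) \<in> O[at_infinity](\<lambda>z. 1 / (cmod z)^3)"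
  shows "(\<forall>\<psi> \<psi>' z. (\<psi>, \<psi>') \<in> spinor_sections \<and> z \<noteq> 0 \<and> \<psi> differentiable (at z) \<longrightarrow>
           dirac U' \<psi>' (- 1 / z) =
             (cmod z)\<^sup>2 *\<^sub>R ((vector [vector [z, 0], vector [0, cnj z]] :: complex^2^2) *v dirac U \<psi> z))
       \<and> bij_betw fst (zero_eigenfunctions U U')
           {\<psi>. dirac_solution U \<psi> \<and>
               (\<lambda>z. (cmod (\<psi> z $ 1))\<^sup>2 + (cmod (\<psi> z $ 2))\<^sup>2) \<in> O[at_infinity](\<lambda>z. 1 / (cmod z)\<^sup>2)}
       \<and> (\<exists>B. finite B \<and> spinors.span B = zero_eigenfunctions U U')
       \<and> even (spinors.dim (zero_eigenfunctions U U'))"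
proof (intro conjI allI impI)
  fix \<psi> \<psi>' z
  assume "(\<psi>, \<psi>') \<in> spinor_sections \<and> z \<noteq> 0 \<and> \<psi> differentiable (at z)"
  then show "dirac U' \<psi>' (- 1 / z) =
      (cmod z)\<^sup>2 *\<^sub>R ((vector [vector [z, 0], vector [0, cnj z]] :: complex^2^2) *v dirac U \<psi> z)"
    using dirac_chart_change(2) assms(3) by blast
next
  show "bij_betw fst (zero_eigenfunctions U U')
           {\<psi>. dirac_solution U \<psi> \<and>
               (\<lambda>z. (cmod (\<psi> z $ 1))\<^sup>2 + (cmod (\<psi> z $ 2))\<^sup>2) \<in> O[at_infinity](\<lambda>z. 1 / (cmod z)\<^sup>2)}"
    unfolding bij_betw_def
  proof (intro conjI zero_eigenfunctions_inj equalityI subsetI)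
    fix \<psi> assume "\<psi> \<in> fst ` zero_eigenfunctions U U'"
    then obtain \<psi>' where "(\<psi>, \<psi>') \<in> zero_eigenfunctions U U'" by auto
    then show "\<psi> \<in> {\<psi>. dirac_solution U \<psi> \<and>
        (\<lambda>z. (cmod (\<psi> z $ 1))\<^sup>2 + (cmod (\<psi> z $ 2))\<^sup>2) \<in> O[at_infinity](\<lambda>z. 1 / (cmod z)\<^sup>2)}"
      using zero_eigenfunction_decay by (auto simp: zero_eigenfunctions_def)
  next
    fix \<psi> assume "\<psi> \<in> {\<psi>. dirac_solution U \<psi> \<and>
        (\<lambda>z. (cmod (\<psi> z $ 1))\<^sup>2 + (cmod (\<psi> z $ 2))\<^sup>2) \<in> O[at_infinity](\<lambda>z. 1 / (cmod z)\<^sup>2)}"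
    then obtain \<psi>' where "(\<psi>, \<psi>') \<in> zero_eigenfunctions U U'"
      using extend_decaying_solution[OF assms(2-4)] by blast
    then show "\<psi> \<in> fst ` zero_eigenfunctions U U'" by force
  qed
next
  show "\<exists>B. finite B \<and> spinors.span B = zero_eigenfunctions U U'"
    by (rule finite_dim_zero_eigenfunctions[OF assms(1,2)])
  show "even (spinors.dim (zero_eigenfunctions U U'))"
    by (rule even_dim_zero_eigenfunctions[OF assms(1,2)])
qed

end
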